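(* Let $n\ge 4$. Among all unicyclic graphs on $n$ vertices, the cycle $C_n$ is the unique graph with maximum sum-connectivity index, which equals $\frac n2$. For $n=4$, $U_{4,3}$ (the triangle with one pendant vertex attached) is the unique graph with the second maximum sum-connectivity index, which equals $1+\frac{2}{\sqrt5}$. For $n\ge5$, the $n$-vertex graphs obtained by attaching a path of length at least two to a vertex of a cycle are exactly the graphs with the second maximum sum-connectivity index, which equals $\frac12(n-4)+\frac1{\sqrt3}+\frac{3}{\sqrt5}$.
   Context: A unicyclic graph is a connected simple graph containing exactly one cycle. For a graph $G$ and vertex $v$, $d_v$ denotes the degree of $v$. The sum-connectivity index is $\chi(G)=\sum_{uv\in E(G)}(d_u+d_v)^{-1/2}$. $C_n$ denotes the cycle on $n$ vertices. Attaching a path of length $r$ to a vertex $u$ means adding a new path on $r$ vertices and an edge between $u$ and one terminal vertex of that path; a path of length at least two thus has at least two vertices. *)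

theory Defs
  imports Complex_Main "Graph_Theory.Graph_Theory"
begin

text \<open>A finite simple graph is a \<^locale>\<open>pair_graph\<close>: each undirected edge is represented by
  its two arcs.  The walk predicate \<^const>\<open>pre_digraph.cycle\<close> is not used for undirected cycles, as it
  admits the walk that traverses one edge back and forth; a cycle of a graph is instead a
  subgraph isomorphic to some \<open>cycle_graph k\<close> with \<open>k \<ge> 3\<close>.\<close>

definition cycle_graph :: "nat \<Rightarrow> nat pair_pre_digraph" where
  "cycle_graph n =
    \<lparr> pverts = {0..<n},
      parcs = {(i, j). i < n \<and> j < n \<and> (j = Suc i mod n \<or> i = Suc j mod n)} \<rparr>"

definition graph_iso :: "'a pair_pre_digraph \<Rightarrow> 'b pair_pre_digraph \<Rightarrow> bool" where
  "graph_iso G H \<longleftrightarrow> digraph_iso (with_proj G) (with_proj H)"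

definition is_cycle_graph :: "'a pair_pre_digraph \<Rightarrow> bool" where
  "is_cycle_graph C \<longleftrightarrow> (\<exists>k\<ge>3. graph_iso C (cycle_graph k))"

definition unicyclic :: "'a pair_pre_digraph \<Rightarrow> bool" where
  "unicyclic G \<longleftrightarrow> pair_graph G \<and> Digraph_Component.connected (with_proj G) \<and>
    (\<exists>!C. subgraph (with_proj C) (with_proj G) \<and> is_cycle_graph C)"

definition unicyclic_graphs :: "nat \<Rightarrow> 'a pair_pre_digraph set" where
  "unicyclic_graphs n = {G. unicyclic G \<and> card (pverts G) = n}"

definition undirected_edges :: "'a pair_pre_digraph \<Rightarrow> 'a set set" where
  "undirected_edges G = (\<lambda>(u, v). {u, v}) ` parcs G"

text \<open>In a symmetric digraph the out-degree of a vertex is its undirected degree, and since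
  there are no loops, the inner sum is \<open>d\<^sub>u + d\<^sub>v\<close> for an edge \<open>{u, v}\<close>.\<close>

definition sum_connectivity_index :: "'a pair_pre_digraph \<Rightarrow> real" where
  "sum_connectivity_index G =
    (\<Sum>e\<in>undirected_edges G. real (\<Sum>v\<in>e. out_degree (with_proj G) v) powr (-1/2))"

text \<open>The list \<open>ws\<close> enumerates the vertices of the attached path, starting with the one
  joined to \<open>u\<close>; its length is the length of the path in the sense used here (number of new
  vertices).  The vertices in \<open>ws\<close> have to be distinct and not in \<open>G\<close>.\<close>

definition attach_path :: "'a pair_pre_digraph \<Rightarrow> 'a \<Rightarrow> 'a list \<Rightarrow> 'a pair_pre_digraph" where
  "attach_path G u ws =
    (let A = set (zip (u # ws) ws)
     in \<lparr> pverts = pverts G \<union> set ws, parcs = parcs G \<union> A \<union> A\<inverse> \<rparr>)"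

definition cycle_with_path :: "nat \<Rightarrow> 'a pair_pre_digraph \<Rightarrow> bool" where
  "cycle_with_path r G \<longleftrightarrow>
    (\<exists>C u ws. is_cycle_graph C \<and> u \<in> pverts C \<and> distinct ws \<and> set ws \<inter> pverts C = {} \<and>
      length ws = r \<and> G = attach_path C u ws)"

definition U_graph :: "nat \<Rightarrow> nat \<Rightarrow> nat pair_pre_digraph" where
  "U_graph n k = attach_path (cycle_graph k) 0 [k..<n]"

definition maximizers :: "('g \<Rightarrow> real) \<Rightarrow> 'g set \<Rightarrow> 'g set" where
  "maximizers f S = {x. is_arg_max f (\<lambda>y. y \<in> S) x}"

definition second_maximizers :: "('g \<Rightarrow> real) \<Rightarrow> 'g set \<Rightarrow> 'g set" where
  "second_maximizers f S = maximizers f (S - maximizers f S)"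

end

theory Submission
  imports Defs
begin

text \<open>By the harmonic-mean inequality and \<open>(1/2 - 1/\<surd>s)\<^sup>2 \<ge> 0\<close>, every edge satisfies
  \<open>1/\<surd>(d\<^sub>u + d\<^sub>v) \<le> 1/4 + (1/d\<^sub>u + 1/d\<^sub>v)/4\<close>.  Summed over the \<open>n\<close> edges of a unicyclic
  graph, the right-hand sides give exactly \<open>n/2\<close>, so the index is \<open>n/2\<close> minus the total slack of
  these inequalities, and edges joining two vertices of degree 2 have no slack.  A unicyclic graph
  without a pendant vertex is a cycle.  A pendant vertex next to a vertex of degree at least 3, or
  two pendant vertices, already cost more than the claimed second value permits.  A single pendant
  vertex next to a vertex of degree 2 forces the degree sequence \<open>3, 2, \<dots>, 2, 1\<close>, and these are the
  cycles with an attached path of length at least two.\<close>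

subsection \<open>Graphs, isomorphisms and cycles\<close>

text \<open>Summed over edges, the second value for n at least 5 is a total slack of 2 - 1/sqrt 3 -
  3/sqrt 5, about 0.0810: one edge between degrees 1 and 2, and three edges between degrees 2 and 3.
  The margin is narrow: a single edge between degrees 1 and 3 has slack 1/12, about 0.0833, and two
  edges between degrees 1 and 2 have 5/4 - 2/sqrt 3, about 0.0953. To beat a competitor it is enough
  to look at its edges at pendant vertices; the slack of the rest is discarded as nonnegative. For n
  = 4 a path of length two does not fit beside a triangle, so this bound is not attained and another
  graph takes second place.

  The structural lemmas assume connectivity, some cycle and at most n edges in place of
  unicyclicity. These properties pass to the graph left by deleting a pendant vertex, so the
  induction that recognises a cycle with an attached path need not transport the uniqueness of the
  cycle.\<close>

definition map_graph :: "('a \<Rightarrow> 'b) \<Rightarrow> 'a pair_pre_digraph \<Rightarrow> 'b pair_pre_digraph" where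
  "map_graph f G = \<lparr> pverts = f ` pverts G, parcs = map_prod f f ` parcs G \<rparr>"

definition neighbours :: "'a pair_pre_digraph \<Rightarrow> 'a \<Rightarrow> 'a set" where
  "neighbours G v = {w. (v, w) \<in> parcs G}"

definition degree :: "'a pair_pre_digraph \<Rightarrow> 'a \<Rightarrow> nat" where
  "degree G v = card (neighbours G v)"

text \<open>Connectivity phrased by vertex sets closed under adjacency, which avoids inductions over
  walks.\<close>

definition linked :: "'a pair_pre_digraph \<Rightarrow> bool" where
  "linked G \<longleftrightarrow> pverts G \<noteq> {} \<and>
    (\<forall>S\<subseteq>pverts G. S \<noteq> {} \<longrightarrow> (\<forall>u v. (u, v) \<in> parcs G \<longrightarrow> u \<in> S \<longrightarrow> v \<in> S) \<longrightarrow> S = pverts G)"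

lemma linkedD:
  assumes "linked G" "S \<subseteq> pverts G" "S \<noteq> {}"
    "\<And>u v. (u, v) \<in> parcs G \<Longrightarrow> u \<in> S \<Longrightarrow> v \<in> S"
  shows "S = pverts G"
  using assms unfolding linked_def by blast

lemma map_graph_simps [simp]:
  "pverts (map_graph f G) = f ` pverts G" "parcs (map_graph f G) = map_prod f f ` parcs G"
  by (simp_all add: map_graph_def)

lemma pair_graph_eqI:
  fixes G H :: "'a pair_pre_digraph"
  shows "pverts G = pverts H \<Longrightarrow> parcs G = parcs H \<Longrightarrow> G = H"
  by simp

lemma out_degree_eq: "out_degree (with_proj G) v = degree G v"
proof -
  have "out_arcs (with_proj G) v = Pair v ` neighbours G v"
    by (auto simp: neighbours_def out_arcs_def)
  then show ?thesis
    by (simp add: out_degree_def degree_def card_image inj_on_def)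
qed

lemma pair_graph_iff:
  "pair_graph G \<longleftrightarrow> finite (pverts G) \<and> parcs G \<subseteq> pverts G \<times> pverts G \<and>
     (\<forall>u v. (u, v) \<in> parcs G \<longrightarrow> (v, u) \<in> parcs G) \<and> (\<forall>u. (u, u) \<notin> parcs G)"
  (is "_ \<longleftrightarrow> ?R")
proof
  assume "pair_graph G"
  then interpret pair_graph G .
  show ?R
    using pair_finite_verts arcs_symmetric no_loops' by (auto dest: in_arcsD1 in_arcsD2)
next
  assume R: ?R
  then have "finite (parcs G)"
    by (meson finite_SigmaI finite_subset)
  with R show "pair_graph G"
    by unfold_locales (auto simp: symmetric_def sym_def)
qed

text \<open>The library's isomorphisms carry separate maps for vertices, arcs, tails and heads. Arcs
  here are pairs of vertices, so the vertex map determines the rest, and an isomorphism is just an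
  injective relabelling.\<close>

lemma graph_iso_iff:
  "graph_iso G H \<longleftrightarrow> parcs G \<subseteq> pverts G \<times> pverts G \<and>
     (\<exists>f. inj_on f (pverts G) \<and> H = map_graph f G)" (is "_ \<longleftrightarrow> ?R")
proof
  assume "graph_iso G H"
  then obtain i where i: "pre_digraph.digraph_isomorphism (with_proj G) i"
    and H: "with_proj H = app_iso i (with_proj G)"
    by (auto simp: graph_iso_def digraph_iso_def)
  have wf: "parcs G \<subseteq> pverts G \<times> pverts G"
    using i by (auto simp: pre_digraph.digraph_isomorphism_def wf_digraph_wp_iff pair_wf_digraph_def)
  \<comment> \<open>The tail and head functions of \<open>with_proj H\<close> are the projections,
    and this forces the arc map to act componentwise.\<close>
  have th: "iso_tail i = fst" "iso_head i = snd"
    using arg_cong[OF H, of tail] arg_cong[OF H, of head] by simp_all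
  have "iso_arcs i a = map_prod (iso_verts i) (iso_verts i) a" if "a \<in> parcs G" for a
    using i that th by (auto simp: pre_digraph.digraph_isomorphism_def prod_eq_iff)
  then have "iso_arcs i ` parcs G = map_prod (iso_verts i) (iso_verts i) ` parcs G"
    by (simp cong: image_cong)
  then have "H = map_graph (iso_verts i) G"
    using arg_cong[OF H, of verts] arg_cong[OF H, of arcs] by (intro pair_graph_eqI) simp_all
  moreover have "inj_on (iso_verts i) (pverts G)"
    using i by (simp add: pre_digraph.digraph_isomorphism_def)
  ultimately show ?R
    using wf by blast
next
  assume ?R
  then obtain f where wf: "parcs G \<subseteq> pverts G \<times> pverts G"
    and inj: "inj_on f (pverts G)" and H: "H = map_graph f G"
    by blast
  let ?i = "\<lparr>iso_verts = f, iso_arcs = map_prod f f, iso_head = snd, iso_tail = fst\<rparr>"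
  have "inj_on (map_prod f f) (parcs G)"
    using map_prod_inj_on[OF inj inj] wf by (rule inj_on_subset)
  then have "pre_digraph.digraph_isomorphism (with_proj G) ?i"
    using inj wf
    by (auto simp: pre_digraph.digraph_isomorphism_def wf_digraph_wp_iff pair_wf_digraph_def)
  moreover have "with_proj H = app_iso ?i (with_proj G)"
    by (simp add: H with_proj_def app_iso_def)
  ultimately show "graph_iso G H"
    by (auto simp: graph_iso_def digraph_iso_def)
qed

lemma map_graph_inverse:
  assumes "inj_on f (pverts G)" "parcs G \<subseteq> pverts G \<times> pverts G"
  shows "map_graph (the_inv_into (pverts G) f) (map_graph f G) = G"
proof (rule pair_graph_eqI)
  show "pverts (map_graph (the_inv_into (pverts G) f) (map_graph f G)) = pverts G"
    using assms(1) by (simp add: the_inv_into_onto)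
  have "map_prod (the_inv_into (pverts G) f) (the_inv_into (pverts G) f) (map_prod f f a) = a"
    if "a \<in> parcs G" for a
    using that assms by (auto simp: the_inv_into_f_f)
  then have "(\<lambda>a. map_prod (the_inv_into (pverts G) f) (the_inv_into (pverts G) f) (map_prod f f a))
      ` parcs G = parcs G"
    by (simp cong: image_cong)
  then show "parcs (map_graph (the_inv_into (pverts G) f) (map_graph f G)) = parcs G"
    by (simp add: image_image)
qed

text \<open>Turns the relabelling around: \<open>G\<close> becomes an image of the model graph
  \<open>H\<close>, so cycles are handled through labels \<open>0, ..., k - 1\<close>.\<close>

lemma graph_iso_iff':
  assumes "parcs H \<subseteq> pverts H \<times> pverts H"
  shows "graph_iso G H \<longleftrightarrow> (\<exists>f. inj_on f (pverts H) \<and> G = map_graph f H)" (is "_ \<longleftrightarrow> ?R")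
proof
  assume "graph_iso G H"
  then obtain f where f: "parcs G \<subseteq> pverts G \<times> pverts G" "inj_on f (pverts G)" "H = map_graph f G"
    by (auto simp: graph_iso_iff)
  with map_graph_inverse[OF f(2,1)] show ?R
    by (metis map_graph_simps(1) inj_on_the_inv_into)
next
  assume ?R
  then obtain f where f: "inj_on f (pverts H)" "G = map_graph f H"
    by blast
  with map_graph_inverse[OF f(1) assms] assms show "graph_iso G H"
    unfolding graph_iso_iff
    by (intro conjI exI[of _ "the_inv_into (pverts H) f"]) (auto intro: inj_on_the_inv_into)
qed

lemma degree_map_graph:
  assumes "inj_on f (pverts G)" "parcs G \<subseteq> pverts G \<times> pverts G" "v \<in> pverts G"
  shows "degree (map_graph f G) (f v) = degree G v"
proof -
  have "neighbours (map_graph f G) (f v) = f ` neighbours G v"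
  proof (intro set_eqI iffI)
    fix w assume "w \<in> neighbours (map_graph f G) (f v)"
    then obtain x y where xy: "(x, y) \<in> parcs G" "f x = f v" "w = f y"
      by (auto simp: neighbours_def)
    then have "x = v"
      using assms by (meson SigmaD1 inj_onD subsetD)
    with xy show "w \<in> f ` neighbours G v"
      by (auto simp: neighbours_def)
  qed (auto simp: neighbours_def)
  moreover have "inj_on f (neighbours G v)"
    using assms by (auto simp: neighbours_def inj_on_def)
  ultimately show ?thesis
    by (simp add: degree_def card_image)
qed

lemma linked_iff_connected:
  assumes "pair_graph G"
  shows "Digraph_Component.connected (with_proj G) \<longleftrightarrow> linked G" (is "?L \<longleftrightarrow> _")
proof -
  interpret pair_graph G by fact
  \<comment> \<open>Connectivity of a digraph means strong connectivity of its symmetric closure;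
    the arcs are already symmetric, so the closure adds nothing.\<close>
  have "parcs (mk_symmetric (with_proj G)) = parcs G"
    using sym_arcs by (rule adj_mk_symmetric_eq)
  then have L: "?L \<longleftrightarrow> pverts G \<noteq> {} \<and>
      (\<forall>u\<in>pverts G. \<forall>v\<in>pverts G. (u, v) \<in> rtrancl_on (pverts G) (parcs G))"
    by (simp add: Digraph_Component.connected_def strongly_connected_def reachable_def)
  show ?thesis
  proof
    assume ?L
    have "v \<in> S" if "S \<subseteq> pverts G" "\<forall>u v. (u, v) \<in> parcs G \<longrightarrow> u \<in> S \<longrightarrow> v \<in> S"
      "u \<in> S" "v \<in> pverts G" for S u v
    proof -
      have "(u, v) \<in> rtrancl_on (pverts G) (parcs G)"
        using \<open>?L\<close> that L by blast
      then show ?thesis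
        by (induct rule: rtrancl_on_induct) (use that in auto)
    qed
    then show "linked G"
      using \<open>?L\<close> L unfolding linked_def by (metis ex_in_conv subsetI subset_antisym)
  next
    assume lk: "linked G"
    have "(u, v) \<in> rtrancl_on (pverts G) (parcs G)" if "u \<in> pverts G" "v \<in> pverts G" for u v
    proof -
      let ?S = "{v. (u, v) \<in> rtrancl_on (pverts G) (parcs G)}"
      have "?S \<subseteq> pverts G"
        by (auto dest: in_rtrancl_on_in_F)
      moreover have "u \<in> ?S"
        using that by simp
      moreover have "\<forall>x y. (x, y) \<in> parcs G \<longrightarrow> x \<in> ?S \<longrightarrow> y \<in> ?S"
        by (auto intro: rtrancl_on_into_rtrancl_on dest: in_arcsD2)
      ultimately have "?S = pverts G"
        using lk unfolding linked_def by blast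
      then show ?thesis
        using that by blast
    qed
    then show ?L
      using L lk by (auto simp: linked_def)
  qed
qed

section \<open>Cycle graphs\<close>

lemma Suc_mod_eq: "(i::nat) < k \<Longrightarrow> Suc i mod k = (if Suc i = k then 0 else Suc i)"
  by auto

text \<open>Only the arcs between \<open>0\<close> and \<open>k - 1\<close> wrap around. Listing
  them separately removes \<open>mod\<close> from all later arguments.\<close>

lemma cycle_graph_arc_iff:
  "(i, j) \<in> parcs (cycle_graph k) \<longleftrightarrow> i < k \<and> j < k \<and>
     (j = Suc i \<or> i = Suc j \<or> i = 0 \<and> Suc j = k \<or> j = 0 \<and> Suc i = k)"
proof -
  have "(i, j) \<in> parcs (cycle_graph k) \<longleftrightarrow> i < k \<and> j < k \<and>
      (j = (if Suc i = k then 0 else Suc i) \<or> i = (if Suc j = k then 0 else Suc j))"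
    using Suc_mod_eq[of i k] Suc_mod_eq[of j k] by (auto simp: cycle_graph_def)
  then show ?thesis
    by (cases "Suc i = k"; cases "Suc j = k") auto
qed

lemma cycle_graph_verts [simp]: "pverts (cycle_graph k) = {0..<k}"
  by (simp add: cycle_graph_def)

lemma pair_graph_cycle_graph:
  assumes "k \<ge> 3"
  shows "pair_graph (cycle_graph k)"
proof -
  have "(j, i) \<in> parcs (cycle_graph k)" if "(i, j) \<in> parcs (cycle_graph k)" for i j
    using that unfolding cycle_graph_arc_iff by blast
  moreover have "(i, i) \<notin> parcs (cycle_graph k)" for i
    using assms by (auto simp: cycle_graph_arc_iff)
  moreover have "parcs (cycle_graph k) \<subseteq> pverts (cycle_graph k) \<times> pverts (cycle_graph k)"
    by (auto simp: cycle_graph_arc_iff)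
  ultimately show ?thesis
    unfolding pair_graph_iff by auto
qed

lemma degree_cycle_graph:
  assumes "k \<ge> 3" "i < k"
  shows "degree (cycle_graph k) i = 2"
proof -
  have "(i, j) \<in> parcs (cycle_graph k) \<longleftrightarrow>
      j = (if Suc i = k then 0 else Suc i) \<or> j = (if i = 0 then k - 1 else i - 1)" for j
    using assms by (cases "i = 0"; cases "Suc i = k") (auto simp: cycle_graph_arc_iff)
  then have "neighbours (cycle_graph k) i =
      {if Suc i = k then 0 else Suc i, if i = 0 then k - 1 else i - 1}"
    by (auto simp only: neighbours_def)
  \<comment> \<open>Here \<open>k \<ge> 3\<close> matters: on two vertices, successor and
    predecessor coincide.\<close>
  moreover have "(if Suc i = k then 0 else Suc i) \<noteq> (if i = 0 then k - 1 else i - 1)"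
    using assms by auto
  ultimately show ?thesis
    by (simp add: degree_def)
qed

lemma linked_cycle_graph:
  assumes "k > 0"
  shows "linked (cycle_graph k)"
  unfolding linked_def
proof (intro conjI allI impI)
  fix S assume S: "S \<subseteq> pverts (cycle_graph k)" "S \<noteq> {}"
    "\<forall>u v. (u, v) \<in> parcs (cycle_graph k) \<longrightarrow> u \<in> S \<longrightarrow> v \<in> S"
  \<comment> \<open>Descending to \<open>0\<close> and climbing up again uses only the arcs between
    consecutive numbers, never the closing edge.\<close>
  have down: "i \<in> S \<Longrightarrow> 0 \<in> S" for i
  proof (induction i)
    case (Suc i)
    then show ?case
      using S(1,3) by (metis cycle_graph_arc_iff Suc_lessD atLeastLessThan_iff cycle_graph_verts subset_iff)
  qed
  have "0 \<in> S"
    using S(2) down by blast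
  then have "i < k \<Longrightarrow> i \<in> S" for i
  proof (induction i)
    case (Suc i)
    then show ?case
      using S(3) by (metis cycle_graph_arc_iff Suc_lessD)
  qed
  with S(1) show "S = pverts (cycle_graph k)"
    by auto
qed (use assms in simp)

lemma linked_map_graph:
  assumes "linked G" "parcs G \<subseteq> pverts G \<times> pverts G"
  shows "linked (map_graph f G)"
  unfolding linked_def
proof (intro conjI allI impI)
  show "pverts (map_graph f G) \<noteq> {}"
    using assms by (simp add: linked_def)
  fix S assume S: "S \<subseteq> pverts (map_graph f G)" "S \<noteq> {}"
    "\<forall>u v. (u, v) \<in> parcs (map_graph f G) \<longrightarrow> u \<in> S \<longrightarrow> v \<in> S"
  let ?T = "{v \<in> pverts G. f v \<in> S}"
  have "f v \<in> S" if "(u, v) \<in> parcs G" "f u \<in> S" for u v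
    using S(3) that by (metis map_graph_simps(2) map_prod_imageI)
  then have "\<forall>u v. (u, v) \<in> parcs G \<longrightarrow> u \<in> ?T \<longrightarrow> v \<in> ?T"
    using assms(2) by blast
  moreover have "?T \<noteq> {}"
    using S(1,2) by auto
  moreover have "?T \<subseteq> pverts G"
    by blast
  ultimately have "?T = pverts G"
    using assms(1) unfolding linked_def by blast
  then show "S = pverts (map_graph f G)"
    using S(1) by auto
qed

lemma pair_graph_map_graph:
  assumes "pair_graph G" "inj_on f (pverts G)"
  shows "pair_graph (map_graph f G)"
proof -
  have "f u \<noteq> f v" if "(u, v) \<in> parcs G" for u v
    using assms that by (auto simp: pair_graph_iff inj_on_def) blast
  moreover have "f u \<in> f ` pverts G \<and> f v \<in> f ` pverts G" "(f v, f u) \<in> map_prod f f ` parcs G"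
    if "(u, v) \<in> parcs G" for u v
    using assms that by (auto simp: pair_graph_iff)
  ultimately show ?thesis
    using assms(1) unfolding pair_graph_iff by auto
qed

lemma is_cycle_graph_iff:
  "is_cycle_graph C \<longleftrightarrow> (\<exists>k f. k \<ge> 3 \<and> inj_on f {0..<k} \<and> C = map_graph f (cycle_graph k))"
proof -
  have "parcs (cycle_graph k) \<subseteq> pverts (cycle_graph k) \<times> pverts (cycle_graph k)" for k
    by (auto simp: cycle_graph_arc_iff)
  then show ?thesis
    unfolding is_cycle_graph_def by (auto simp: graph_iso_iff')
qed

lemma
  assumes "is_cycle_graph C"
  shows pair_graph_cycle: "pair_graph C"
    and linked_cycle: "linked C"
    and degree_cycle: "v \<in> pverts C \<Longrightarrow> degree C v = 2"
    and card_cycle: "card (pverts C) \<ge> 3"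
proof -
  obtain k f where k: "k \<ge> 3" "inj_on f {0..<k}" "C = map_graph f (cycle_graph k)"
    using assms by (auto simp: is_cycle_graph_iff)
  note g = pair_graph_cycle_graph[OF k(1)]
  show "pair_graph C"
    using k g by (simp add: pair_graph_map_graph)
  show "linked C"
    using k g by (simp add: pair_graph_iff linked_map_graph linked_cycle_graph)
  show "card (pverts C) \<ge> 3"
    using k by (simp add: card_image)
  show "degree C v = 2" if "v \<in> pverts C"
    using that k g by (auto simp: degree_map_graph pair_graph_iff degree_cycle_graph)
qed

lemma unicyclic_iff:
  "unicyclic G \<longleftrightarrow> pair_graph G \<and> linked G \<and>
     (\<exists>!C. is_cycle_graph C \<and> pverts C \<subseteq> pverts G \<and> parcs C \<subseteq> parcs G)"
proof (cases "pair_graph G")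
  case True
  have "subgraph (with_proj C) (with_proj G) \<and> is_cycle_graph C \<longleftrightarrow>
      is_cycle_graph C \<and> pverts C \<subseteq> pverts G \<and> parcs C \<subseteq> parcs G" for C
    using True pair_graph_cycle[of C]
    by (auto simp: subgraph_def compatible_def wf_digraph_wp_iff pair_wf_digraph_def pair_graph_iff)
  then show ?thesis
    using True by (simp add: unicyclic_def linked_iff_connected)
qed (simp add: unicyclic_def)

subsection \<open>Counting edges\<close>

lemma finite_neighbours: "pair_graph G \<Longrightarrow> finite (neighbours G v)"
  by (rule finite_subset[of _ "pverts G"]) (auto simp: neighbours_def pair_graph_iff)

lemma finite_parcs: "pair_graph G \<Longrightarrow> finite (parcs G)"
  by (rule finite_subset[of _ "pverts G \<times> pverts G"]) (auto simp: pair_graph_iff)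

lemma parcs_eq_Sigma: "pair_graph G \<Longrightarrow> parcs G = Sigma (pverts G) (neighbours G)"
  by (auto simp: neighbours_def pair_graph_iff)

lemma handshake:
  assumes "pair_graph G"
  shows "card (parcs G) = (\<Sum>v\<in>pverts G. degree G v)"
proof -
  have "finite (pverts G)"
    using assms by (simp add: pair_graph_iff)
  then show ?thesis
    by (simp add: parcs_eq_Sigma[OF assms] degree_def finite_neighbours[OF assms])
qed

lemma is_cycle_graph_of_closed_path:
  assumes "pair_graph G" "distinct xs" "length xs \<ge> 3"
    and arcs: "\<And>i. Suc i < length xs \<Longrightarrow> (xs ! i, xs ! Suc i) \<in> parcs G"
    and closing: "(last xs, hd xs) \<in> parcs G"
  shows "\<exists>C. is_cycle_graph C \<and> parcs C \<subseteq> parcs G"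
proof -
  let ?k = "length xs"
  let ?C = "map_graph ((!) xs) (cycle_graph ?k)"
  have "inj_on ((!) xs) {0..<?k}"
    using assms(2) by (simp add: inj_on_nth)
  then have "is_cycle_graph ?C"
    using assms(3) by (auto simp: is_cycle_graph_iff)
  moreover have "(xs ! i, xs ! j) \<in> parcs G" if "(i, j) \<in> parcs (cycle_graph ?k)" for i j
  proof -
    have sym: "(v, u) \<in> parcs G" if "(u, v) \<in> parcs G" for u v
      using that assms(1) by (simp add: pair_graph_iff)
    have closing': "(xs ! l, xs ! 0) \<in> parcs G" if "Suc l = ?k" for l
    proof -
      have "xs \<noteq> []" "l = ?k - 1"
        using assms(3) that by auto
      then show ?thesis
        using closing by (simp add: last_conv_nth hd_conv_nth)
    qed
    have "j = Suc i \<or> i = Suc j \<or> i = 0 \<and> Suc j = ?k \<or> j = 0 \<and> Suc i = ?k"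
      "i < ?k" "j < ?k"
      using that by (simp_all add: cycle_graph_arc_iff)
    then show ?thesis
      using arcs closing' sym by blast
  qed
  ultimately show ?thesis
    by (intro exI[of _ ?C]) auto
qed

text \<open>The first vertex of a longest path has all its neighbours on the path.\<close>

lemma min_degree_two_imp_cycle:
  assumes G: "pair_graph G" and "pverts G \<noteq> {}"
    and deg: "\<And>v. v \<in> pverts G \<Longrightarrow> degree G v \<ge> 2"
  shows "\<exists>C. is_cycle_graph C \<and> parcs C \<subseteq> parcs G"
proof -
  let ?P = "\<lambda>xs. xs \<noteq> [] \<and> distinct xs \<and> set xs \<subseteq> pverts G \<and>
    successively (\<lambda>u v. (u, v) \<in> parcs G) xs"
  obtain v where "v \<in> pverts G"
    using assms(2) by blast
  then have "?P [v]"
    by simp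
  moreover have "length xs < Suc (card (pverts G))" if "?P xs" for xs
    using that G by (metis card_mono distinct_card less_Suc_eq_le pair_graph_iff)
  \<comment> \<open>A path has no more vertices than the graph, so a longest one exists.\<close>
  ultimately obtain xs where xs: "?P xs" and longest: "\<And>ys. ?P ys \<Longrightarrow> length ys \<le> length xs"
    using ex_has_greatest_nat[of ?P "[v]" length "Suc (card (pverts G))"] by metis
  obtain x xs' where x: "xs = x # xs'"
    using xs by (cases xs) auto
  have "neighbours G x \<subseteq> set xs'"
  proof
    fix w assume "w \<in> neighbours G x"
    then have w: "(w, x) \<in> parcs G" "w \<in> pverts G" "w \<noteq> x"
      using G by (auto simp: neighbours_def pair_graph_iff)
    have "\<not> ?P (w # xs)"
      using longest[of "w # xs"] by auto
    then show "w \<in> set xs'"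
      using xs w by (auto simp: x)
  qed
  moreover have "degree G x \<ge> 2"
    using xs deg by (simp add: x)
  \<comment> \<open>One neighbour may be the next vertex of the path; degree 2 provides another one
    \<open>y\<close> further along, and the initial segment up to \<open>y\<close> closes to a cycle
    of length at least 3.\<close>
  then have "\<not> neighbours G x \<subseteq> {hd xs'}"
    using card_mono[of "{hd xs'}" "neighbours G x"] by (auto simp: degree_def)
  ultimately obtain y where y: "y \<in> neighbours G x" "y \<in> set xs'" "y \<noteq> hd xs'"
    by blast
  then obtain as bs where split: "xs' = as @ y # bs" "as \<noteq> []"
    by (metis append_Nil list.sel(1) split_list)
  let ?ys = "x # as @ [y]"
  have "successively (\<lambda>u v. (u, v) \<in> parcs G) (?ys @ bs)"
    using xs split x by simp
  then have "successively (\<lambda>u v. (u, v) \<in> parcs G) ?ys"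
    by (simp only: successively_append_iff)
  then have "(?ys ! i, ?ys ! Suc i) \<in> parcs G" if "Suc i < length ?ys" for i
    using that by (simp only: successively_conv_nth)
  moreover have "distinct ?ys"
    using xs split x by auto
  moreover have "length ?ys \<ge> 3"
    using split(2) by (cases as) auto
  moreover have "(last ?ys, hd ?ys) \<in> parcs G"
    using y G by (simp add: neighbours_def pair_graph_iff)
  ultimately show ?thesis
    by (intro is_cycle_graph_of_closed_path[OF G, of ?ys])
qed

section \<open>Many edges force a cycle\<close>

definition del_vertex :: "'a pair_pre_digraph \<Rightarrow> 'a \<Rightarrow> 'a pair_pre_digraph" where
  "del_vertex G p =
    \<lparr> pverts = pverts G - {p}, parcs = {(u, v). (u, v) \<in> parcs G \<and> u \<noteq> p \<and> v \<noteq> p} \<rparr>"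

lemma del_vertex_simps [simp]:
  "pverts (del_vertex G p) = pverts G - {p}"
  "(u, v) \<in> parcs (del_vertex G p) \<longleftrightarrow> (u, v) \<in> parcs G \<and> u \<noteq> p \<and> v \<noteq> p"
  by (simp_all add: del_vertex_def)

lemma pair_graph_del_vertex: "pair_graph G \<Longrightarrow> pair_graph (del_vertex G p)"
  unfolding pair_graph_iff by (auto simp: subset_iff)

lemma card_parcs_del_vertex:
  assumes "pair_graph G"
  shows "card (parcs G) = card (parcs (del_vertex G p)) + 2 * degree G p"
proof -
  let ?N = "neighbours G p"
  have "parcs G = parcs (del_vertex G p) \<union> (Pair p ` ?N \<union> (\<lambda>v. (v, p)) ` ?N)"
    using assms by (auto simp: neighbours_def pair_graph_iff)
  moreover have "card (parcs (del_vertex G p) \<union> (Pair p ` ?N \<union> (\<lambda>v. (v, p)) ` ?N)) =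
      card (parcs (del_vertex G p)) + (card (Pair p ` ?N) + card ((\<lambda>v. (v, p)) ` ?N))"
    using assms finite_neighbours[OF assms] finite_parcs[OF pair_graph_del_vertex[OF assms]]
    by (subst card_Un_disjoint; (subst card_Un_disjoint)?) (auto simp: neighbours_def pair_graph_iff)
  moreover have "card (Pair p ` ?N) = degree G p" "card ((\<lambda>v. (v, p)) ` ?N) = degree G p"
    by (simp_all add: degree_def card_image inj_on_def)
  ultimately show ?thesis
    by simp
qed

text \<open>This is the bound for forests in contrapositive form. A vertex of degree at most 1 takes
  at most two arcs with it, so the inequality survives its deletion; if there is no such vertex, the
  minimum degree is 2. The \<open>+ 1\<close> absorbs parity: the number of arcs is even, so the
  condition still means at least as many edges as vertices.\<close>

lemma many_arcs_imp_cycle: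
  assumes "pair_graph G" "pverts G \<noteq> {}" "2 * card (pverts G) \<le> card (parcs G) + 1"
  shows "\<exists>C. is_cycle_graph C \<and> parcs C \<subseteq> parcs G"
  using assms
proof (induction "card (pverts G)" arbitrary: G rule: less_induct)
  case less
  show ?case
  proof (cases "\<forall>v\<in>pverts G. degree G v \<ge> 2")
    case True
    then show ?thesis
      using min_degree_two_imp_cycle less.prems by blast
  next
    case False
    then obtain p where p: "p \<in> pverts G" "degree G p \<le> 1"
      by force
    let ?H = "del_vertex G p"
    have fin: "finite (pverts G)"
      using less.prems(1) by (simp add: pair_graph_iff)
    then have card: "card (pverts ?H) + 1 = card (pverts G)"
      using card_Suc_Diff1[OF fin p(1)] by simp
    have "pverts ?H \<noteq> {}"
    proof
      assume "pverts ?H = {}"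
      then have "pverts G = {p}"
        using p(1) by auto
      then have "parcs G = {}"
        using less.prems(1) by (auto simp: pair_graph_iff)
      then show False
        using less.prems(3) \<open>pverts G = {p}\<close> by simp
    qed
    moreover have "2 * card (pverts ?H) \<le> card (parcs ?H) + 1"
      using card less.prems(3) p(2) card_parcs_del_vertex[OF less.prems(1), of p] by linarith
    ultimately obtain C where "is_cycle_graph C" "parcs C \<subseteq> parcs ?H"
      using less.hyps[of ?H] less.prems(1) card pair_graph_del_vertex by force
    moreover have "parcs ?H \<subseteq> parcs G"
      by auto
    ultimately show ?thesis
      by blast
  qed
qed

lemma cycle_has_arc:
  assumes "is_cycle_graph C"
  obtains u v where "(u, v) \<in> parcs C"
proof -
  obtain v where "v \<in> pverts C"
    using linked_cycle[OF assms] by (auto simp: linked_def)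
  then have "neighbours C v \<noteq> {}"
    using degree_cycle[OF assms] by (force simp: degree_def)
  then show thesis
    using that by (auto simp: neighbours_def)
qed

text \<open>Each vertex of a cycle is an end of one of its arcs, so containment of cycles can be
  stated by arcs alone.\<close>

lemma cycle_verts_subset:
  assumes "is_cycle_graph C" "parcs C \<subseteq> parcs G" "pair_graph G"
  shows "pverts C \<subseteq> pverts G"
proof
  fix v assume "v \<in> pverts C"
  then have "neighbours C v \<noteq> {}"
    using degree_cycle[OF assms(1)] by (force simp: degree_def)
  then show "v \<in> pverts G"
    using assms(2,3) by (auto simp: neighbours_def pair_graph_iff)
qed

text \<open>Without an edge of its only cycle, a unicyclic graph is a forest.\<close>

lemma card_parcs_unicyclic_le:
  assumes "unicyclic G"
  shows "card (parcs G) \<le> 2 * card (pverts G)"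
proof (rule ccontr)
  assume many: "\<not> ?thesis"
  from assms have G: "pair_graph G" "pverts G \<noteq> {}"
    by (auto simp: unicyclic_iff linked_def)
  obtain C where C: "is_cycle_graph C" "parcs C \<subseteq> parcs G"
    and unique: "\<And>D. is_cycle_graph D \<Longrightarrow> parcs D \<subseteq> parcs G \<Longrightarrow> D = C"
    using assms cycle_verts_subset unfolding unicyclic_iff by metis
  obtain u v where uv: "(u, v) \<in> parcs C"
    using cycle_has_arc[OF C(1)] .
  \<comment> \<open>At least \<open>2n + 1\<close> arcs leave at least \<open>2n - 1\<close> after
    this deletion, enough for a cycle \<open>D\<close>. It avoids the edge \<open>uv\<close> and
    hence differs from \<open>C\<close>.\<close>
  let ?H = "\<lparr> pverts = pverts G, parcs = parcs G - {(u, v), (v, u)} \<rparr>"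
  have H: "pair_graph ?H"
    using G(1) by (auto simp: pair_graph_iff)
  have "card (parcs G) \<le> card (parcs ?H) + card {(u, v), (v, u)}"
    using diff_card_le_card_Diff[of "{(u, v), (v, u)}" "parcs G"] by simp
  moreover have "card {(u, v), (v, u)} \<le> 2"
    by (simp add: card_insert_le_m1)
  ultimately have "2 * card (pverts ?H) \<le> card (parcs ?H) + 1"
    using many by simp
  then obtain D where "is_cycle_graph D" "parcs D \<subseteq> parcs ?H"
    using many_arcs_imp_cycle[OF H] G(2) by auto
  then show False
    using unique[of D] uv by auto
qed

lemma degree_pos:
  assumes "pair_graph G" "linked G" "card (pverts G) \<ge> 2" "v \<in> pverts G"
  shows "degree G v \<ge> 1"
proof (rule ccontr)
  assume "\<not> ?thesis"
  then have "neighbours G v = {}"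
    using finite_neighbours[OF assms(1)] by (simp add: degree_def not_le)
  then have "\<forall>x y. (x, y) \<in> parcs G \<longrightarrow> x \<in> {v} \<longrightarrow> y \<in> {v}"
    by (auto simp: neighbours_def)
  then have "{v} = pverts G"
    using assms(2,4) unfolding linked_def by blast
  then show False
    using assms(3) by (metis card.empty card_insert_if empty_iff finite.emptyI numeral_le_one_iff
        One_nat_def semiring_norm(69))
qed

text \<open>If the vertices of \<open>C\<close> have degree 2 in \<open>G\<close>, then
  \<open>C\<close> already uses all their edges, so its vertex set is closed under adjacency and
  connectivity makes it everything. With a cycle as the ambient graph, the same argument shows that
  a cycle contains no other cycle.\<close>

lemma two_regular_eq_cycle:
  assumes G: "pair_graph G" "linked G" and C: "is_cycle_graph C" "parcs C \<subseteq> parcs G"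
    and deg: "\<And>v. v \<in> pverts C \<Longrightarrow> degree G v = 2"
  shows "G = C"
proof -
  have sub: "pverts C \<subseteq> pverts G"
    using cycle_verts_subset C G(1) by blast
  have nb: "neighbours G v = neighbours C v" if "v \<in> pverts C" for v
  proof -
    have "neighbours C v \<subseteq> neighbours G v"
      using C(2) by (auto simp: neighbours_def)
    moreover have "card (neighbours C v) = card (neighbours G v)"
      using deg[OF that] degree_cycle[OF C(1) that] by (simp add: degree_def)
    ultimately show ?thesis
      using finite_neighbours[OF G(1)] by (metis card_subset_eq)
  qed
  have "\<forall>x y. (x, y) \<in> parcs G \<longrightarrow> x \<in> pverts C \<longrightarrow> y \<in> pverts C"
    using nb pair_graph_cycle[OF C(1)] by (auto simp: neighbours_def pair_graph_iff)
  moreover have "pverts C \<noteq> {}"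
    using linked_cycle[OF C(1)] by (simp add: linked_def)
  ultimately have "pverts C = pverts G"
    using G(2) sub unfolding linked_def by blast
  with nb show ?thesis
    by (intro pair_graph_eqI)
      (simp_all add: parcs_eq_Sigma[OF G(1)] parcs_eq_Sigma[OF pair_graph_cycle[OF C(1)]] cong: Sigma_cong)
qed

text \<open>All degrees are at least 2 while the handshake sum keeps their average at most 2, so
  they all equal 2.\<close>

lemma no_pendant_eq_cycle:
  assumes G: "pair_graph G" "linked G" and C: "is_cycle_graph C" "parcs C \<subseteq> parcs G"
    and le: "card (parcs G) \<le> 2 * card (pverts G)"
    and np: "\<And>v. v \<in> pverts G \<Longrightarrow> degree G v \<noteq> 1"
  shows "G = C"
proof (rule two_regular_eq_cycle[OF G C])
  have sub: "pverts C \<subseteq> pverts G"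
    using cycle_verts_subset C G(1) by blast
  have fin: "finite (pverts G)"
    using G(1) by (simp add: pair_graph_iff)
  have "card (pverts G) \<ge> 2"
    using card_mono[OF fin sub] card_cycle[OF C(1)] by linarith
  then have ge: "degree G v \<ge> 2" if "v \<in> pverts G" for v
    using degree_pos[OF G _ that] np[OF that] by linarith
  fix v assume v: "v \<in> pverts C"
  show "degree G v = 2"
  proof (rule ccontr)
    assume "degree G v \<noteq> 2"
    then have "2 < degree G v"
      using ge[of v] sub v by fastforce
    then have "(\<Sum>v\<in>pverts G. 2) < (\<Sum>v\<in>pverts G. degree G v)"
      using ge v sub by (intro sum_strict_mono_ex1[OF fin]) auto
    then show False
      using le handshake[OF G(1)] by simp
  qed
qed

subsection \<open>Pendant vertices\<close>

definition add_pendant :: "'a pair_pre_digraph \<Rightarrow> 'a \<Rightarrow> 'a \<Rightarrow> 'a pair_pre_digraph" where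
  "add_pendant G x w =
    \<lparr> pverts = insert w (pverts G), parcs = {(x, w), (w, x)} \<union> parcs G \<rparr>"

lemma add_pendant_simps [simp]:
  "pverts (add_pendant G x w) = insert w (pverts G)"
  "parcs (add_pendant G x w) = {(x, w), (w, x)} \<union> parcs G"
  by (simp_all add: add_pendant_def)

context
  fixes G :: "'a pair_pre_digraph" and x w :: 'a
  assumes G: "pair_graph G" and x: "x \<in> pverts G" and w: "w \<notin> pverts G"
begin

lemma pair_graph_add_pendant: "pair_graph (add_pendant G x w)"
  using G x w by (auto simp: pair_graph_iff)

lemma neighbours_add_pendant:
  "neighbours (add_pendant G x w) v =
    (if v = w then {x} else if v = x then insert w (neighbours G x) else neighbours G v)"
  using G x w by (auto simp: neighbours_def pair_graph_iff)

lemma degree_add_pendant: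
  "degree (add_pendant G x w) v =
    (if v = w then 1 else if v = x then Suc (degree G x) else degree G v)"
proof -
  have "w \<notin> neighbours G x"
    using G w by (auto simp: neighbours_def pair_graph_iff)
  then show ?thesis
    using finite_neighbours[OF G] by (simp add: degree_def neighbours_add_pendant)
qed

lemma linked_add_pendant:
  assumes "linked G"
  shows "linked (add_pendant G x w)"
  unfolding linked_def
proof (intro conjI allI impI)
  fix S assume S: "S \<subseteq> pverts (add_pendant G x w)" "S \<noteq> {}"
    "\<forall>u v. (u, v) \<in> parcs (add_pendant G x w) \<longrightarrow> u \<in> S \<longrightarrow> v \<in> S"
  have "x \<in> S \<or> w \<in> S" if "S \<inter> pverts G = {}"
    using S(1,2) that by auto
  moreover have xw: "x \<in> S \<longleftrightarrow> w \<in> S"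
    using S(3) by auto
  ultimately have "S \<inter> pverts G \<noteq> {}"
    using x by blast
  moreover have "\<forall>u v. (u, v) \<in> parcs G \<longrightarrow> u \<in> S \<inter> pverts G \<longrightarrow> v \<in> S \<inter> pverts G"
    using S(3) G by (auto simp: pair_graph_iff)
  moreover have "S \<inter> pverts G \<subseteq> pverts G"
    by blast
  ultimately have "S \<inter> pverts G = pverts G"
    using assms unfolding linked_def by blast
  then show "S = pverts (add_pendant G x w)"
    using S(1) x xw by auto
qed simp

text \<open>A vertex with a single neighbour lies on no cycle, so adding a pendant vertex creates
  none.\<close>

lemma cycle_add_pendant_iff:
  assumes "is_cycle_graph C"
  shows "parcs C \<subseteq> parcs (add_pendant G x w) \<longleftrightarrow> parcs C \<subseteq> parcs G"
proof
  assume sub: "parcs C \<subseteq> parcs (add_pendant G x w)"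
  have "w \<notin> pverts C"
  proof
    assume "w \<in> pverts C"
    moreover have "neighbours C w \<subseteq> neighbours (add_pendant G x w) w"
      using sub by (auto simp: neighbours_def)
    then have "card (neighbours C w) \<le> 1"
      using card_mono[of "{x}"] by (simp add: neighbours_add_pendant)
    ultimately show False
      using degree_cycle[OF assms] by (simp add: degree_def)
  qed
  then show "parcs C \<subseteq> parcs G"
    using sub pair_graph_cycle[OF assms] by (auto simp: pair_graph_iff)
qed auto

end

lemma unicyclic_iff_parcs:
  "unicyclic G \<longleftrightarrow> pair_graph G \<and> linked G \<and> (\<exists>!C. is_cycle_graph C \<and> parcs C \<subseteq> parcs G)"
  unfolding unicyclic_iff using cycle_verts_subset[of _ G] by (metis (no_types, lifting))

lemma unicyclic_add_pendant:
  assumes "unicyclic G" "x \<in> pverts G" "w \<notin> pverts G"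
  shows "unicyclic (add_pendant G x w)"
proof -
  have G: "pair_graph G"
    using assms(1) by (simp add: unicyclic_iff)
  have "is_cycle_graph C \<and> parcs C \<subseteq> parcs (add_pendant G x w) \<longleftrightarrow>
      is_cycle_graph C \<and> parcs C \<subseteq> parcs G" for C
    using cycle_add_pendant_iff[OF G assms(2,3)] by blast
  then show ?thesis
    using assms pair_graph_add_pendant[OF G] linked_add_pendant[OF G]
    unfolding unicyclic_iff_parcs by simp
qed

lemma unicyclic_cycle:
  assumes "is_cycle_graph C"
  shows "unicyclic C"
proof -
  note C = pair_graph_cycle[OF assms] linked_cycle[OF assms]
  have "D = C" if D: "is_cycle_graph D" "parcs D \<subseteq> parcs C" for D
    using two_regular_eq_cycle[OF C D] degree_cycle[OF assms] cycle_verts_subset[OF D C(1)] by blast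
  then show ?thesis
    using assms C unfolding unicyclic_iff_parcs by blast
qed

lemma pendant_decomp:
  assumes "pair_graph G" "degree G p = 1"
  obtains q where "neighbours G p = {q}" "q \<in> pverts G" "q \<noteq> p"
    "G = add_pendant (del_vertex G p) q p"
proof -
  obtain q where q: "neighbours G p = {q}"
    using assms(2) by (auto simp: degree_def card_1_singleton_iff)
  then have pq: "(p, v) \<in> parcs G \<longleftrightarrow> v = q" for v
    by (auto simp: neighbours_def)
  then have qp: "(v, p) \<in> parcs G \<longleftrightarrow> v = q" for v
    using assms(1) by (metis pair_graph_iff)
  have G: "p \<in> pverts G" "q \<in> pverts G" "q \<noteq> p"
    using pq[of q] assms(1) by (auto simp: pair_graph_iff)
  have "G = add_pendant (del_vertex G p) q p"
  proof (rule pair_graph_eqI)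
    show "pverts G = pverts (add_pendant (del_vertex G p) q p)"
      using G(1) by (simp add: insert_absorb)
    have "(u, v) \<in> parcs G \<longleftrightarrow> (u, v) \<in> parcs (add_pendant (del_vertex G p) q p)" for u v
      using pq[of v] qp[of u] G(3) by (cases "u = p"; cases "v = p") auto
    then show "parcs G = parcs (add_pendant (del_vertex G p) q p)"
      by (intro subset_antisym subrelI; blast)
  qed
  with q G that show thesis
    by blast
qed

lemma linked_del_pendant:
  assumes "pair_graph G" "linked G" "degree G p = 1"
  shows "linked (del_vertex G p)"
  unfolding linked_def
proof (intro conjI allI impI)
  obtain q where q: "neighbours G p = {q}" "q \<in> pverts G" "q \<noteq> p"
    using pendant_decomp[OF assms(1,3)] by blast
  then show "pverts (del_vertex G p) \<noteq> {}"
    by auto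
  fix S assume S: "S \<subseteq> pverts (del_vertex G p)" "S \<noteq> {}"
    "\<forall>u v. (u, v) \<in> parcs (del_vertex G p) \<longrightarrow> u \<in> S \<longrightarrow> v \<in> S"
  have pq: "(p, v) \<in> parcs G \<longleftrightarrow> v = q" "(v, p) \<in> parcs G \<longleftrightarrow> v = q" for v
    using q(1) assms(1) by (auto simp: neighbours_def pair_graph_iff)
  have p: "p \<in> pverts G"
    using pq(1)[of q] assms(1) by (auto simp: pair_graph_iff)
  \<comment> \<open>A closed set of the smaller graph becomes closed in \<open>G\<close> once
    \<open>p\<close> joins whenever its only neighbour \<open>q\<close> is present.\<close>
  let ?T = "if q \<in> S then insert p S else S"
  have "?T \<subseteq> pverts G" "?T \<noteq> {}"
    using S(1,2) p by auto
  moreover have "\<forall>u v. (u, v) \<in> parcs G \<longrightarrow> u \<in> ?T \<longrightarrow> v \<in> ?T"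
  proof (intro allI impI)
    fix u v assume uv: "(u, v) \<in> parcs G" "u \<in> ?T"
    have "p \<notin> S"
      using S(1) by auto
    show "v \<in> ?T"
    proof (cases "u = p \<or> v = p")
      case True
      then show ?thesis
        using uv pq \<open>p \<notin> S\<close> q(3) by (auto split: if_splits)
    next
      case False
      then have "v \<in> S"
        using uv S(3) by (auto split: if_splits)
      then show ?thesis
        by simp
    qed
  qed
  ultimately have "?T = pverts G"
    using assms(2) unfolding linked_def by blast
  then show "S = pverts (del_vertex G p)"
    using S(1) p by (auto split: if_splits)
qed

section \<open>Attaching a path vertex by vertex\<close>

lemma attach_path_Nil [simp]: "attach_path G u [] = G"
  by (simp add: attach_path_def)

lemma zip_Cons_snoc:
  "zip (u # ws @ [w]) (ws @ [w]) = zip (u # ws) ws @ [(last (u # ws), w)]"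
  by (induction ws arbitrary: u) auto

text \<open>Read from its far end, an attached path is a sequence of pendant additions. Hence the
  inductions over \<open>ws\<close> use \<open>rev_induct\<close>.\<close>

lemma attach_path_snoc:
  "attach_path G u (ws @ [w]) = add_pendant (attach_path G u ws) (last (u # ws)) w"
  by (rule pair_graph_eqI) (auto simp: attach_path_def Let_def zip_Cons_snoc simp del: zip_Cons_Cons)

lemma pverts_attach_path [simp]: "pverts (attach_path G u ws) = pverts G \<union> set ws"
  by (simp add: attach_path_def Let_def)

lemma unicyclic_attach_path:
  assumes "is_cycle_graph C" "u \<in> pverts C" "distinct ws" "set ws \<inter> pverts C = {}"
  shows "unicyclic (attach_path C u ws)"
  using assms(3,4)
proof (induction ws rule: rev_induct)
  case Nil
  then show ?case
    using unicyclic_cycle[OF assms(1)] by simp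
next
  case (snoc w ws)
  then show ?case
    unfolding attach_path_snoc using assms(2) by (intro unicyclic_add_pendant) auto
qed

lemma degree_attach_path_snoc:
  assumes "is_cycle_graph C" "u \<in> pverts C" "distinct (ws @ [w])" "set (ws @ [w]) \<inter> pverts C = {}"
  shows "degree (attach_path C u (ws @ [w])) v =
    (if v = w then 1 else if v = last (u # ws) then Suc (degree (attach_path C u ws) v)
     else degree (attach_path C u ws) v)"
proof -
  have "pair_graph (attach_path C u ws)"
    using unicyclic_attach_path[OF assms(1,2)] assms(3,4) by (simp add: unicyclic_iff)
  then show ?thesis
    unfolding attach_path_snoc using assms(2-4) by (subst degree_add_pendant) auto
qed

lemma pendant_attach_path_iff:
  assumes "is_cycle_graph C" "u \<in> pverts C" "distinct ws" "set ws \<inter> pverts C = {}"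
    "v \<in> pverts C \<union> set ws"
  shows "degree (attach_path C u ws) v = 1 \<longleftrightarrow> ws \<noteq> [] \<and> v = last ws"
  using assms(3-5)
proof (induction ws arbitrary: v rule: rev_induct)
  case Nil
  then show ?case
    using degree_cycle[OF assms(1)] by simp
next
  case (snoc w ws)
  \<comment> \<open>The former end has degree at least 1, so attaching \<open>w\<close> lifts it to
    at least 2 and leaves \<open>w\<close> as the only pendant vertex.\<close>
  have "degree (attach_path C u ws) v \<ge> 1" if "v \<noteq> w"
  proof (rule degree_pos)
    have uni: "unicyclic (attach_path C u ws)"
      using unicyclic_attach_path[OF assms(1,2)] snoc.prems by simp
    then show "pair_graph (attach_path C u ws)" "linked (attach_path C u ws)"
      by (simp_all add: unicyclic_iff)
    show "card (pverts (attach_path C u ws)) \<ge> 2"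
      using card_cycle[OF assms(1)] card_mono[of "pverts C \<union> set ws" "pverts C"]
        pair_graph_cycle[OF assms(1)] by (simp add: pair_graph_iff)
    show "v \<in> pverts (attach_path C u ws)"
      using snoc.prems that by auto
  qed
  then show ?case
    using snoc degree_attach_path_snoc[OF assms(1,2) snoc.prems(1,2), of v] by auto
qed

text \<open>Induction by deleting the pendant vertex \<open>p\<close>. Only its neighbour
  \<open>q\<close> loses an edge, so at most \<open>q\<close> can become pendant and the last
  hypothesis is inherited. The path found for the smaller graph then ends in \<open>q\<close>, and
  \<open>p\<close> prolongs it. Having no pendant vertex at all is the base case, with the empty
  path.\<close>

lemma one_pendant_eq_attach_path:
  assumes "pair_graph G" "linked G" "is_cycle_graph C" "parcs C \<subseteq> parcs G"
    "card (parcs G) \<le> 2 * card (pverts G)"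
    "\<And>v w. v \<in> pverts G \<Longrightarrow> w \<in> pverts G \<Longrightarrow> degree G v = 1 \<Longrightarrow> degree G w = 1 \<Longrightarrow> v = w"
  shows "\<exists>u ws. u \<in> pverts C \<and> distinct ws \<and> set ws \<inter> pverts C = {} \<and> G = attach_path C u ws"
  using assms
proof (induction "card (pverts G)" arbitrary: G rule: less_induct)
  case less
  note G = less.prems(1) and C = less.prems(3)
  show ?case
  proof (cases "\<exists>p\<in>pverts G. degree G p = 1")
    case False
    then have "G = C"
      using no_pendant_eq_cycle less.prems by blast
    moreover obtain u where "u \<in> pverts C"
      using linked_cycle[OF C] by (auto simp: linked_def)
    ultimately show ?thesis
      by (intro exI[of _ u] exI[of _ "[]"]) simp
  next
    case True
    then obtain p where p: "p \<in> pverts G" "degree G p = 1"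
      by blast
    then obtain q where q: "neighbours G p = {q}" "q \<in> pverts G" "q \<noteq> p"
      and Gq: "G = add_pendant (del_vertex G p) q p"
      using pendant_decomp[OF G] by blast
    let ?H = "del_vertex G p"
    have H: "pair_graph ?H"
      using G by (rule pair_graph_del_vertex)
    have qH: "q \<in> pverts ?H" "p \<notin> pverts ?H"
      using q by auto
    have degG: "degree G v = (if v = p then 1 else if v = q then Suc (degree ?H q) else degree ?H v)" for v
      using degree_add_pendant[OF H qH] Gq by simp
    have CH: "parcs C \<subseteq> parcs ?H"
      using cycle_add_pendant_iff[OF H qH C] Gq less.prems(4) by simp
    have card: "card (pverts ?H) + 1 = card (pverts G)"
      using card_Suc_Diff1[of "pverts G" p] p(1) G by (simp add: pair_graph_iff)
    have unique: "v = p" if "v \<in> pverts G" "degree G v = 1" for v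
      using less.prems(6) p that by blast
    have pendH: "v = q" if "v \<in> pverts ?H" "degree ?H v = 1" for v
      using unique[of v] degG[of v] that by (auto split: if_splits)
    have "\<exists>u ws. u \<in> pverts C \<and> distinct ws \<and> set ws \<inter> pverts C = {} \<and> ?H = attach_path C u ws"
    proof (rule less.hyps[OF _ H _ C CH])
      show "card (pverts ?H) < card (pverts G)"
        using card by simp
      show "linked ?H"
        using linked_del_pendant[OF G less.prems(2) p(2)] .
      show "card (parcs ?H) \<le> 2 * card (pverts ?H)"
        using card less.prems(5) card_parcs_del_vertex[OF G, of p] p(2) by simp
      show "v = w" if "v \<in> pverts ?H" "w \<in> pverts ?H" "degree ?H v = 1" "degree ?H w = 1" for v w
        using pendH[of v] pendH[of w] that by simp
    qed
    then obtain u ws where ws: "u \<in> pverts C" "distinct ws" "set ws \<inter> pverts C = {}"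
      "?H = attach_path C u ws"
      by blast
    have disj: "p \<notin> pverts C" "p \<notin> set ws"
    proof -
      have "pverts G - {p} = pverts C \<union> set ws"
        using arg_cong[OF ws(4), of pverts] by simp
      then show "p \<notin> pverts C" "p \<notin> set ws"
        by blast+
    qed
    show ?thesis
    \<comment> \<open>For an empty path the vertex \<open>u\<close> from the induction hypothesis
      carries no information; \<open>q\<close> itself becomes the point of attachment.\<close>
    proof (cases "ws = []")
      case True
      then have "G = attach_path C q [p]"
        using Gq ws(4) attach_path_snoc[of C q "[]" p] by simp
      moreover have "q \<in> pverts C"
        using qH ws(4) True by simp
      ultimately show ?thesis
        using disj by (intro exI[of _ q] exI[of _ "[p]"]) auto
    next
      case False
      have "last ws \<in> pverts ?H" "degree ?H (last ws) = 1"
        using pendant_attach_path_iff[OF C ws(1-3), of "last ws"] ws(4) False by auto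
      then have "last ws = q"
        using pendH by blast
      then have "G = attach_path C u (ws @ [p])"
        using Gq ws(4) False by (simp add: attach_path_snoc)
      then show ?thesis
        using ws disj by (intro exI[of _ u] exI[of _ "ws @ [p]"]) auto
    qed
  qed
qed

subsection \<open>The slack of an edge\<close>

definition edge_slack :: "nat \<Rightarrow> nat \<Rightarrow> real" where
  "edge_slack a b = 1/4 + (1 / real a + 1 / real b) / 4 - 1 / sqrt (real (a + b))"

lemma edge_slack_commute: "edge_slack a b = edge_slack b a"
  by (simp add: edge_slack_def add.commute)

lemma edge_slack_nonneg:
  assumes "a > 0" "b > 0"
  shows "edge_slack a b \<ge> 0"
proof -
  let ?x = "real a" and ?y = "real b"
  have pos: "?x > 0" "?y > 0"
    using assms by simp_all
  have "4 * (?x * ?y) \<le> (?x + ?y) * (?x + ?y)"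
    using zero_le_square[of "?x - ?y"] by (simp add: algebra_simps)
  then have harm: "1 / (?x + ?y) \<le> (1 / ?x + 1 / ?y) / 4"
    using pos by (simp add: field_simps)
  have "(1/2 - 1 / sqrt (?x + ?y))\<^sup>2 = 1/4 + 1 / (?x + ?y) - 1 / sqrt (?x + ?y)"
    using pos by (simp add: power2_diff power_divide)
  then have "1 / sqrt (?x + ?y) \<le> 1/4 + 1 / (?x + ?y)"
    using zero_le_power2[of "1/2 - 1 / sqrt (?x + ?y)"] by linarith
  then show ?thesis
    using harm unfolding edge_slack_def of_nat_add by linarith
qed

lemma edge_slack_values:
  "edge_slack 2 2 = 0"
  "edge_slack 1 2 = 5/8 - 1 / sqrt 3"
  "edge_slack 2 3 = 11/24 - 1 / sqrt 5"
  by (simp_all add: edge_slack_def)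

text \<open>The constant 1/12 is \<open>edge_slack 1 3\<close>, so the bound is attained at
  \<open>b = 3\<close>.\<close>

lemma edge_slack_1_ge:
  assumes "b \<ge> 3"
  shows "edge_slack 1 b \<ge> 1/12"
proof -
  define s where "s = sqrt (real (1 + b))"
  have s2: "s * s = 1 + real b"
    by (simp add: s_def)
  have s: "s \<ge> 2"
    using assms by (auto simp: s_def intro: real_le_rsqrt)
  \<comment> \<open>With \<open>b = s * s - 1\<close>, clearing denominators turns the claim into a
    cubic in \<open>s\<close> that vanishes at \<open>s = 2\<close>, that is at
    \<open>b = 3\<close>. Expanded in powers of \<open>s - 2\<close>, the cofactor has positive
    coefficients only.\<close>
  have "0 \<le> (s - 2) * (5 * (s - 2) * (s - 2) + 18 * (s - 2) + 10)"
    using s by (intro mult_nonneg_nonneg add_nonneg_nonneg) auto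
  also have "\<dots> = 5 * s * (s * s - 1) - 12 * (s * s - 1) + 3 * s"
    by (simp add: algebra_simps)
  finally have "12 * (real b) \<le> 5 * s * real b + 3 * s"
    by (simp add: s2)
  then have "1 / s \<le> 5/12 + 1 / (4 * real b)"
    using s assms by (simp add: field_simps)
  moreover have "edge_slack 1 b = 1/2 + 1 / (4 * real b) - 1 / s"
    by (simp add: edge_slack_def s_def add_divide_distrib)
  ultimately show ?thesis
    by linarith
qed

lemma inverse_sqrt_bounds:
  "5773/10000 < 1 / sqrt 3" "1 / sqrt 3 < 5774/10000" "4472/10000 < 1 / sqrt 5" "1 / sqrt 5 < 4473/10000"
proof -
  have sq: "(1 / sqrt 3)\<^sup>2 = 1/3" "(1 / sqrt 5)\<^sup>2 = 1/5"
    by (simp_all add: power_divide)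
  show "5773/10000 < 1 / sqrt 3" "1 / sqrt 3 < 5774/10000" "4472/10000 < 1 / sqrt 5" "1 / sqrt 5 < 4473/10000"
    by (rule power2_less_imp_less; simp add: sq; simp add: power2_eq_square)+
qed

section \<open>Sums over edges and sums over arcs\<close>

lemma sum_arcs_eq_sum_edges:
  fixes g :: "'a set \<Rightarrow> real"
  assumes "pair_graph G"
  shows "(\<Sum>(u, v)\<in>parcs G. g {u, v}) = 2 * (\<Sum>e\<in>undirected_edges G. g e)"
proof -
  let ?\<phi> = "\<lambda>(u, v). {u, v}"
  have "(\<Sum>a\<in>parcs G. g (?\<phi> a)) =
      (\<Sum>e\<in>?\<phi> ` parcs G. \<Sum>a | a \<in> parcs G \<and> ?\<phi> a = e. g (?\<phi> a))"
    using finite_parcs[OF assms] by (rule sum.image_gen)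
  also have "\<dots> = (\<Sum>e\<in>?\<phi> ` parcs G. 2 * g e)"
  proof (rule sum.cong[OF refl])
    fix e assume "e \<in> ?\<phi> ` parcs G"
    then obtain u v where uv: "(u, v) \<in> parcs G" "e = {u, v}"
      by auto
    then have "(v, u) \<in> parcs G" "u \<noteq> v"
      using assms by (auto simp: pair_graph_iff)
    then have "{a. a \<in> parcs G \<and> ?\<phi> a = e} = {(u, v), (v, u)}"
      using uv by (auto simp: doubleton_eq_iff)
    then show "(\<Sum>a | a \<in> parcs G \<and> ?\<phi> a = e. g (?\<phi> a)) = 2 * g e"
      using uv \<open>u \<noteq> v\<close> by (simp add: insert_commute)
  qed
  finally show ?thesis
    by (simp add: undirected_edges_def sum_distrib_left case_prod_unfold)
qed

lemma even_card_parcs: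
  assumes "pair_graph G"
  shows "even (card (parcs G))"
proof -
  have "real (card (parcs G)) = real (2 * card (undirected_edges G))"
    using sum_arcs_eq_sum_edges[OF assms, of "\<lambda>_. 1"] by simp
  then show ?thesis
    by (metis dvd_triv_left of_nat_eq_iff)
qed

lemma sum_connectivity_index_arcs:
  assumes "pair_graph G"
  shows "2 * sum_connectivity_index G =
    (\<Sum>(u, v)\<in>parcs G. 1 / sqrt (real (degree G u + degree G v)))"
proof -
  let ?g = "\<lambda>e. real (\<Sum>v\<in>e. degree G v) powr (-1/2)"
  have "2 * sum_connectivity_index G = (\<Sum>(u, v)\<in>parcs G. ?g {u, v})"
    unfolding sum_arcs_eq_sum_edges[OF assms, of ?g] sum_connectivity_index_def out_degree_eq ..
  also have "\<dots> = (\<Sum>(u, v)\<in>parcs G. 1 / sqrt (real (degree G u + degree G v)))"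
  proof (rule sum.cong[OF refl], clarify)
    fix u v assume "(u, v) \<in> parcs G"
    then have "u \<noteq> v"
      using assms by (auto simp: pair_graph_iff)
    then have "?g {u, v} = real (degree G u + degree G v) powr - (1/2)"
      by simp
    also have "\<dots> = 1 / sqrt (real (degree G u + degree G v))"
      by (simp only: powr_minus_divide powr_half_sqrt of_nat_0_le_iff)
    finally show "?g {u, v} = 1 / sqrt (real (degree G u + degree G v))" .
  qed
  finally show ?thesis .
qed

text \<open>A vertex of degree d is the tail of d arcs of weight 1/d, in total 1. Reversing all arcs
  gives the second sum.\<close>

lemma sum_inverse_degree:
  assumes "pair_graph G" "\<forall>v\<in>pverts G. degree G v \<ge> 1"
  shows "(\<Sum>(u, v)\<in>parcs G. 1 / real (degree G u)) = card (pverts G)"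
    and "(\<Sum>(u, v)\<in>parcs G. 1 / real (degree G v)) = card (pverts G)"
proof -
  have "(\<Sum>(u, v)\<in>parcs G. 1 / real (degree G u)) =
      (\<Sum>u\<in>pverts G. \<Sum>v\<in>neighbours G u. 1 / real (degree G u))"
    using assms(1) finite_neighbours[OF assms(1)]
    unfolding parcs_eq_Sigma[OF assms(1)] by (subst sum.Sigma) (auto simp: pair_graph_iff)
  also have "\<dots> = (\<Sum>u\<in>pverts G. 1)"
  proof (rule sum.cong[OF refl])
    fix u assume "u \<in> pverts G"
    then show "(\<Sum>v\<in>neighbours G u. 1 / real (degree G u)) = 1"
      using assms(2) by (force simp: degree_def[symmetric])
  qed
  finally show 1: "(\<Sum>(u, v)\<in>parcs G. 1 / real (degree G u)) = card (pverts G)"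
    by simp
  have "(\<Sum>(u, v)\<in>parcs G. 1 / real (degree G v)) = (\<Sum>(u, v)\<in>parcs G. 1 / real (degree G u))"
    using assms(1)
    by (intro sum.reindex_bij_witness[of _ "\<lambda>(u, v). (v, u)" "\<lambda>(u, v). (v, u)"])
      (auto simp: pair_graph_iff)
  with 1 show "(\<Sum>(u, v)\<in>parcs G. 1 / real (degree G v)) = card (pverts G)"
    by simp
qed

text \<open>Everything is doubled because each edge is counted as two arcs. The number of arcs stays
  in the formula, since for unicyclic graphs only its upper bound \<open>2n\<close> has been
  established; with exactly \<open>2n\<close> arcs the first two terms sum to
  \<open>n\<close>.\<close>

lemma sum_connectivity_index_slack:
  assumes "pair_graph G" "\<forall>v\<in>pverts G. degree G v \<ge> 1"
  shows "2 * sum_connectivity_index G = card (parcs G) / 4 + card (pverts G) / 2 -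
    (\<Sum>(u, v)\<in>parcs G. edge_slack (degree G u) (degree G v))"
proof -
  have "(\<Sum>(u, v)\<in>parcs G. edge_slack (degree G u) (degree G v)) =
      (\<Sum>(u, v)\<in>parcs G. 1/4) +
      ((\<Sum>(u, v)\<in>parcs G. 1 / real (degree G u)) + (\<Sum>(u, v)\<in>parcs G. 1 / real (degree G v))) / 4 -
      (\<Sum>(u, v)\<in>parcs G. 1 / sqrt (real (degree G u + degree G v)))"
    by (simp add: edge_slack_def case_prod_unfold sum_subtractf sum.distrib sum_divide_distrib[symmetric])
  moreover have "(\<Sum>(u, v)\<in>parcs G. 1/4 :: real) = card (parcs G) / 4"
    by (simp add: case_prod_unfold)
  ultimately show ?thesis
    using sum_inverse_degree[OF assms] sum_connectivity_index_arcs[OF assms(1)] by argo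
qed

lemma sum_connectivity_index_cycle:
  assumes "is_cycle_graph G"
  shows "sum_connectivity_index G = card (pverts G) / 2"
proof -
  note G = pair_graph_cycle[OF assms] and deg = degree_cycle[OF assms]
  have "(\<Sum>(u, v)\<in>parcs G. edge_slack (degree G u) (degree G v)) = 0"
    using G deg by (intro sum.neutral) (auto simp: pair_graph_iff subset_iff edge_slack_values)
  moreover have "card (parcs G) = 2 * card (pverts G)"
    using handshake[OF G] deg by simp
  ultimately show ?thesis
    using sum_connectivity_index_slack[OF G] deg by simp
qed

text \<open>A description by degrees of the cycles with an attached path of length at least two;
  degrees are all that the index depends on.\<close>

definition tailed :: "'a pair_pre_digraph \<Rightarrow> bool" where
  "tailed G \<longleftrightarrow> (\<exists>p\<in>pverts G. degree G p = 1 \<and> (\<forall>v\<in>pverts G. degree G v = 1 \<longrightarrow> v = p) \<and>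
     (\<forall>q\<in>neighbours G p. degree G q = 2))"

text \<open>Two adjacent pendant vertices would form a whole component.\<close>

lemma pendant_neighbour_degree:
  assumes "pair_graph G" "linked G" "card (pverts G) \<ge> 3" "degree G p = 1" "q \<in> neighbours G p"
  shows "degree G q \<ge> 2"
proof (rule ccontr)
  assume "\<not> ?thesis"
  moreover have pq: "(p, q) \<in> parcs G" "(q, p) \<in> parcs G"
    using assms(1,5) by (auto simp: neighbours_def pair_graph_iff)
  moreover have "q \<in> pverts G" "p \<in> pverts G"
    using pq assms(1) by (auto simp: pair_graph_iff)
  ultimately have "degree G q = 1"
    using degree_pos[OF assms(1,2), of q] assms(3) by simp
  then have "neighbours G q = {p}" "neighbours G p = {q}"
    using pq assms(4) by (auto simp: degree_def card_1_singleton_iff neighbours_def set_eq_iff)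
  then have "y \<in> {p, q}" if "(x, y) \<in> parcs G" "x \<in> {p, q}" for x y
    using that by (auto simp: neighbours_def)
  then have "{p, q} = pverts G"
    using \<open>q \<in> pverts G\<close> \<open>p \<in> pverts G\<close> by (intro linkedD[OF assms(2)]) auto
  then show False
    using assms(3) card_insert_le_m1[of 2 "{q}" p] by simp
qed

text \<open>Apart from \<open>p\<close> all degrees are at least 2, and the edge bound limits their
  total excess over 2 to 1. Parity excludes excess 0, so there is exactly one vertex
  \<open>z\<close> of degree 3. It is not adjacent to \<open>p\<close>, whose neighbour has degree
  2. Hence slack occurs only on the two arcs at \<open>p\<close> and the six arcs at
  \<open>z\<close>.\<close>

lemma sum_connectivity_index_tailed:
  assumes G: "pair_graph G" and le: "card (parcs G) \<le> 2 * card (pverts G)"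
    and pos: "\<forall>v\<in>pverts G. degree G v \<ge> 1" and "tailed G"
  shows "sum_connectivity_index G = (real (card (pverts G)) - 4) / 2 + 1 / sqrt 3 + 3 / sqrt 5"
proof -
  obtain p where p: "p \<in> pverts G" "degree G p = 1"
    and only: "\<And>v. v \<in> pverts G \<Longrightarrow> degree G v = 1 \<Longrightarrow> v = p"
    and q2: "\<And>q. q \<in> neighbours G p \<Longrightarrow> degree G q = 2"
    using \<open>tailed G\<close> unfolding tailed_def by blast
  obtain q where q: "neighbours G p = {q}" "q \<noteq> p"
    using pendant_decomp[OF G p(2)] by blast
  have dq: "degree G q = 2"
    using q q2 by simp
  have sym: "(u, v) \<in> parcs G \<longleftrightarrow> (v, u) \<in> parcs G" for u v
    using G by (meson pair_graph_iff)
  have fin: "finite (pverts G)"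
    using G by (simp add: pair_graph_iff)
  let ?V = "pverts G - {p}"
  have ge2: "degree G v \<ge> 2" if "v \<in> ?V" for v
    using pos only[of v] that by force
  have "card (parcs G) = 1 + (\<Sum>v\<in>?V. degree G v)"
    using handshake[OF G] sum.remove[OF fin p(1), of "degree G"] p(2) by simp
  also have "(\<Sum>v\<in>?V. degree G v) = (\<Sum>v\<in>?V. 2 + (degree G v - 2))"
    using ge2 by (intro sum.cong[OF refl]) (simp only: le_add_diff_inverse)
  also have "\<dots> = 2 * card ?V + (\<Sum>v\<in>?V. degree G v - 2)"
    by (simp only: sum.distrib) simp
  finally have m: "card (parcs G) = 1 + (2 * card ?V + (\<Sum>v\<in>?V. degree G v - 2))" .
  have cV: "card (pverts G) = Suc (card ?V)"
    using card_Suc_Diff1[OF fin p(1)] by simp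
  have sum1: "(\<Sum>v\<in>?V. degree G v - 2) = 1"
  proof -
    \<comment> \<open>Without excess there would be \<open>2n - 1\<close> arcs, an odd
      number.\<close>
    have "(\<Sum>v\<in>?V. degree G v - 2) \<noteq> 0"
    proof
      assume "(\<Sum>v\<in>?V. degree G v - 2) = 0"
      with m have "card (parcs G) = 1 + 2 * card ?V"
        by simp
      then show False
        using even_card_parcs[OF G] by simp
    qed
    then show ?thesis
      using m cV le by linarith
  qed
  then obtain z where z: "z \<in> ?V" "degree G z - 2 = 1"
    and "\<And>v. v \<in> ?V \<Longrightarrow> z \<noteq> v \<Longrightarrow> degree G v - 2 = 0"
    using fin by (subst (asm) sum_eq_1_iff) auto
  then have dz: "degree G z = 3" and d2: "\<And>v. v \<in> ?V \<Longrightarrow> v \<noteq> z \<Longrightarrow> degree G v = 2"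
    using ge2 by force+
  let ?N = "neighbours G z"
  have zN: "z \<notin> ?N"
    using G by (auto simp: neighbours_def pair_graph_iff)
  have pN: "p \<notin> ?N"
    using q2[of z] dz sym[of p z] by (auto simp: neighbours_def)
  have NV: "?N \<subseteq> pverts G"
    using G by (auto simp: neighbours_def pair_graph_iff)
  let ?P = "{(p, q), (q, p)}"
  let ?Z = "{z} \<times> ?N \<union> ?N \<times> {z}"
  let ?h = "\<lambda>(u, v). edge_slack (degree G u) (degree G v)"
  have P_sub: "?P \<subseteq> parcs G"
    using q sym by (auto simp: neighbours_def)
  have Z_sub: "?Z \<subseteq> parcs G"
    using sym by (auto simp: neighbours_def)
  have finN: "finite ?N"
    using finite_neighbours[OF G] .
  have "sum ?h (parcs G) = sum ?h (?P \<union> ?Z)"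
  proof (rule sum.mono_neutral_right[OF finite_parcs[OF G]])
    show "\<forall>a\<in>parcs G - (?P \<union> ?Z). ?h a = 0"
    proof
      fix a assume a: "a \<in> parcs G - (?P \<union> ?Z)"
      obtain u v where uv: "a = (u, v)"
        by (cases a)
      have "u \<noteq> p" "v \<noteq> p" "u \<noteq> z" "v \<noteq> z"
        using a q(1) sym[of u v] by (auto simp: neighbours_def uv)
      moreover have "u \<in> pverts G" "v \<in> pverts G"
        using a G by (auto simp: pair_graph_iff uv)
      ultimately show "?h a = 0"
        by (simp add: d2 edge_slack_values uv)
    qed
  qed (use P_sub Z_sub in blast)
  also have "\<dots> = sum ?h ?P + sum ?h ?Z"
    using finN pN z(1) by (intro sum.union_disjoint) auto
  also have "sum ?h ?P = 2 * edge_slack 1 2"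
    using q(2) p(2) dq edge_slack_commute[of 2 1] by simp
  also have "sum ?h ?Z = (\<Sum>a\<in>?Z. edge_slack 2 3)"
  proof (rule sum.cong[OF refl])
    fix a assume "a \<in> ?Z"
    then obtain w where "w \<in> ?N" "a = (z, w) \<or> a = (w, z)"
      by blast
    moreover from this have "degree G w = 2"
      using NV pN zN by (intro d2) auto
    ultimately show "?h a = edge_slack 2 3"
      using dz edge_slack_commute[of 2 3] by auto
  qed
  also have "\<dots> = 6 * edge_slack 2 3"
  proof -
    have "card ?Z = card ({z} \<times> ?N) + card (?N \<times> {z})"
      using finN zN by (intro card_Un_disjoint) auto
    then have "card ?Z = 6"
      using dz by (simp add: degree_def card_cartesian_product)
    then show ?thesis
      by (simp only: sum_constant)
  qed
  \<comment> \<open>The rational parts, 2 times 5/8 and 6 times 11/24, add up to 4.\<close>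
  finally have "sum ?h (parcs G) = 4 - 2 * (1 / sqrt 3) - 6 * (1 / sqrt 5)"
    unfolding edge_slack_values by simp
  moreover have "real (card (parcs G)) = 2 * real (card (pverts G))"
    using m cV sum1 by simp
  moreover have "3 / sqrt 5 = 3 * (1 / sqrt 5)"
    by simp
  ultimately show ?thesis
    using sum_connectivity_index_slack[OF G pos] by argo
qed

text \<open>All slacks are nonnegative, so a few arcs whose slack exceeds the total slack 4 - 2/sqrt
  3 - 6/sqrt 5 of a tailed graph, about 0.162, settle the claim.\<close>

lemma sum_connectivity_index_less:
  assumes G: "pair_graph G" "linked G" and le: "card (parcs G) \<le> 2 * card (pverts G)"
    and "card (pverts G) \<ge> 3" and "\<exists>p\<in>pverts G. degree G p = 1" and "\<not> tailed G"
  shows "sum_connectivity_index G < (real (card (pverts G)) - 4) / 2 + 1 / sqrt 3 + 3 / sqrt 5"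
proof -
  let ?h = "\<lambda>(u, v). edge_slack (degree G u) (degree G v)"
  have pos: "\<forall>v\<in>pverts G. degree G v \<ge> 1"
    using degree_pos[OF G] assms(4) by simp
  have nonneg: "?h a \<ge> 0" if "a \<in> parcs G" for a
  proof (cases a)
    case (Pair u v)
    then have "u \<in> pverts G" "v \<in> pverts G"
      using that G(1) by (auto simp: pair_graph_iff)
    then show ?thesis
      using pos Pair by (force intro: edge_slack_nonneg)
  qed
  have bound: "sum ?h A \<le> sum ?h (parcs G)" if "A \<subseteq> parcs G" for A
    using nonneg that by (intro sum_mono2[OF finite_parcs[OF G(1)]]) auto
  have pair: "\<exists>q. neighbours G p = {q} \<and> q \<noteq> p \<and> {(p, q), (q, p)} \<subseteq> parcs G \<and> degree G q \<ge> 2"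
    if d1: "degree G p = 1" for p
  proof -
    obtain q where q: "neighbours G p = {q}" "q \<noteq> p"
      using pendant_decomp[OF G(1) d1] by blast
    then have "(p, q) \<in> parcs G"
      by (auto simp: neighbours_def)
    with q show ?thesis
      using pendant_neighbour_degree[OF G assms(4) d1] G(1) by (auto simp: pair_graph_iff)
  qed
  have "4 - 2 * (1 / sqrt 3) - 6 * (1 / sqrt 5) < sum ?h (parcs G)"
  proof (cases "\<exists>p q. degree G p = 1 \<and> q \<in> neighbours G p \<and> degree G q \<noteq> 2")
    case True
    then obtain p q where p: "degree G p = 1" "q \<in> neighbours G p" "degree G q \<noteq> 2"
      by blast
    with pair[OF p(1)] have q: "q \<noteq> p" "{(p, q), (q, p)} \<subseteq> parcs G" "degree G q \<ge> 3"
      by auto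
    \<comment> \<open>The two arcs of this one pendant edge contribute at least 1/6, about
      0.167.\<close>
    have "2 / 12 \<le> edge_slack 1 (degree G q) + edge_slack (degree G q) 1"
      using edge_slack_1_ge[OF q(3)] edge_slack_commute[of 1] by simp
    also have "\<dots> = sum ?h {(p, q), (q, p)}"
      using q(1) p(1) by simp
    also have "\<dots> \<le> sum ?h (parcs G)"
      using bound q(2) .
    finally show ?thesis
      using inverse_sqrt_bounds by linarith
  next
    case False
    obtain p where p: "p \<in> pverts G" "degree G p = 1"
      using assms(5) by blast
    \<comment> \<open>Every pendant vertex now has a neighbour of degree 2, so \<open>tailed\<close>
      can only fail through a second pendant vertex.\<close>
    then obtain p' where p': "degree G p' = 1" "p' \<noteq> p"
      using \<open>\<not> tailed G\<close> False unfolding tailed_def by blast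
    obtain q where q: "q \<noteq> p" "{(p, q), (q, p)} \<subseteq> parcs G" "degree G q = 2"
      using pair[OF p(2)] False p(2) by auto
    obtain q' where q': "q' \<noteq> p'" "{(p', q'), (q', p')} \<subseteq> parcs G" "degree G q' = 2"
      using pair[OF p'(1)] False p'(1) by auto
    have ne: "q \<noteq> p'" "q' \<noteq> p"
      using p(2) p'(1) q(3) q'(3) by auto
    \<comment> \<open>The four arcs are distinct even if \<open>q = q'\<close>; their slack is about
      0.191.\<close>
    have "4 * edge_slack 1 2 = sum ?h {(p, q), (q, p), (p', q'), (q', p')}"
      using p(2) p' q(1,3) q'(1,3) ne edge_slack_commute[of 2 1] by simp
    also have "\<dots> \<le> sum ?h (parcs G)"
      using bound q(2) q'(2) by simp
    finally show ?thesis
      unfolding edge_slack_values using inverse_sqrt_bounds by argo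
  qed
  moreover have "real (card (parcs G)) \<le> 2 * real (card (pverts G))"
    using le by linarith
  moreover have "3 / sqrt 5 = 3 * (1 / sqrt 5)"
    by simp
  ultimately show ?thesis
    using sum_connectivity_index_slack[OF G(1) pos] by argo
qed

subsection \<open>Extremal graphs\<close>

lemma graph_iso_cycle_graph_iff:
  assumes "n \<ge> 3"
  shows "graph_iso G (cycle_graph n) \<longleftrightarrow> is_cycle_graph G \<and> card (pverts G) = n" (is "?L \<longleftrightarrow> ?R")
proof -
  have iso: "graph_iso G (cycle_graph k) \<longleftrightarrow> (\<exists>f. inj_on f {0..<k} \<and> G = map_graph f (cycle_graph k))"
    for k
    by (subst graph_iso_iff') (auto simp: cycle_graph_arc_iff)
  have "card (pverts G) = k" if "graph_iso G (cycle_graph k)" for k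
    using that unfolding iso by (auto simp: card_image)
  then show ?thesis
    unfolding is_cycle_graph_def using assms by blast
qed

lemma map_graph_attach_path:
  "map_graph f (attach_path G u ws) = attach_path (map_graph f G) (f u) (map f ws)"
proof (rule pair_graph_eqI)
  have "zip (f u # map f ws) (map f ws) = map (map_prod f f) (zip (u # ws) ws)"
    by (metis list.simps(9) zip_map_map map_prod_def)
  then have "set (zip (f u # map f ws) (map f ws)) = map_prod f f ` set (zip (u # ws) ws)"
    by simp
  moreover have "(map_prod f f ` R)\<inverse> = map_prod f f ` (R\<inverse>)" for R
    by force
  ultimately show "parcs (map_graph f (attach_path G u ws)) =
      parcs (attach_path (map_graph f G) (f u) (map f ws))"
    by (simp add: attach_path_def Let_def image_Un)
qed auto

text \<open>Shows that the sets of candidates are inhabited: after numbering \<open>V\<close>, the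
  first \<open>k\<close> vertices carry the cycle and the other \<open>r\<close> the path.\<close>

lemma ex_cycle_with_path:
  fixes V :: "'a set"
  assumes "finite V" "card V = k + r" "k \<ge> 3"
  shows "\<exists>G :: 'a pair_pre_digraph. card (pverts G) = k + r \<and> cycle_with_path r G"
proof -
  obtain f where f: "bij_betw f {0..<k + r} V"
    using assms ex_bij_betw_nat_finite by metis
  then have inj: "inj_on f {0..<k + r}"
    by (simp add: bij_betw_def)
  let ?C = "map_graph f (cycle_graph k)" and ?ws = "map f [k..<k + r]"
  have C: "is_cycle_graph ?C"
    using assms(3) inj_on_subset[OF inj, of "{0..<k}"] by (auto simp: is_cycle_graph_iff)
  moreover have "f 0 \<in> pverts ?C"
    using assms(3) by simp
  moreover have "distinct ?ws"
    using inj_on_subset[OF inj, of "{k..<k + r}"] by (simp add: distinct_map)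
  moreover have "{k..<k + r} \<inter> {0..<k} = {}"
    by auto
  then have "set ?ws \<inter> pverts ?C = {}"
    using inj_on_image_Int[OF inj, of "{k..<k + r}" "{0..<k}"] by simp
  moreover have "length ?ws = r"
    by simp
  ultimately have "cycle_with_path r (attach_path ?C (f 0) ?ws)"
    unfolding cycle_with_path_def by blast
  moreover have "pverts (attach_path ?C (f 0) ?ws) = f ` {0..<k + r}"
    by (simp add: image_Un[symmetric] ivl_disj_un)
  then have "card (pverts (attach_path ?C (f 0) ?ws)) = k + r"
    by (simp add: card_image[OF inj])
  ultimately show ?thesis
    by blast
qed

lemma unicyclic_cycle_with_path:
  assumes "cycle_with_path r G"
  shows "unicyclic G"
  using assms by (auto simp: cycle_with_path_def intro: unicyclic_attach_path)

lemma cycle_with_path_pendant: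
  assumes "cycle_with_path r G" "r \<ge> 1"
  shows "\<exists>p\<in>pverts G. degree G p = 1"
proof -
  obtain C u ws where C: "is_cycle_graph C" "u \<in> pverts C" "distinct ws" "set ws \<inter> pverts C = {}"
    and ws: "length ws = r" "G = attach_path C u ws"
    using assms(1) unfolding cycle_with_path_def by blast
  have "ws \<noteq> []"
    using ws(1) assms(2) by auto
  then show ?thesis
    using pendant_attach_path_iff[OF C, of "last ws"] ws(2) by (intro bexI[of _ "last ws"]) auto
qed

lemma unicyclic_cases:
  assumes "unicyclic G"
  obtains (cycle) "is_cycle_graph G" | (pendant) "\<exists>p\<in>pverts G. degree G p = 1"
proof -
  obtain C where "is_cycle_graph C" "parcs C \<subseteq> parcs G"
    using assms unfolding unicyclic_iff by blast
  then show thesis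
    using no_pendant_eq_cycle[of G C] card_parcs_unicyclic_le[OF assms] assms that
    unfolding unicyclic_iff by blast
qed

lemma cycle_no_pendant: "is_cycle_graph G \<Longrightarrow> \<not> (\<exists>p\<in>pverts G. degree G p = 1)"
  by (simp add: degree_cycle)

lemma unique_pendant_imp_cycle_with_path:
  assumes "unicyclic G" "\<And>v w. v \<in> pverts G \<Longrightarrow> w \<in> pverts G \<Longrightarrow> degree G v = 1 \<Longrightarrow> degree G w = 1 \<Longrightarrow> v = w"
  shows "\<exists>r. cycle_with_path r G"
proof -
  obtain C where C: "is_cycle_graph C" "parcs C \<subseteq> parcs G"
    using assms unfolding unicyclic_iff by blast
  then have "\<exists>u ws. u \<in> pverts C \<and> distinct ws \<and> set ws \<inter> pverts C = {} \<and> G = attach_path C u ws"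
    using assms card_parcs_unicyclic_le[OF assms(1)]
    by (intro one_pendant_eq_attach_path) (auto simp: unicyclic_iff)
  with C(1) show ?thesis
    unfolding cycle_with_path_def by blast
qed

lemma neighbours_last_attach_path:
  assumes "is_cycle_graph C" "u \<in> pverts C" "distinct (ws @ [w])" "set (ws @ [w]) \<inter> pverts C = {}"
  shows "neighbours (attach_path C u (ws @ [w])) w = {last (u # ws)}"
proof -
  have "pair_graph (attach_path C u ws)"
    using unicyclic_attach_path[OF assms(1,2)] assms(3,4) by (simp add: unicyclic_iff)
  then show ?thesis
    unfolding attach_path_snoc using assms(2-4) by (subst neighbours_add_pendant) auto
qed

text \<open>Given a unique pendant vertex, \<open>G\<close> is a cycle with some path. Length 1 is
  excluded because the neighbour of the pendant vertex would be \<open>u\<close>, which has degree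
  3. Conversely, a path of length at least 2 has a last vertex but one inside the path.\<close>

lemma tailed_iff_cycle_with_path:
  assumes "unicyclic G"
  shows "tailed G \<longleftrightarrow> (\<exists>r\<ge>2. cycle_with_path r G)"
proof
  assume "tailed G"
  then obtain p where p: "p \<in> pverts G" "degree G p = 1"
    and only: "\<And>v. v \<in> pverts G \<Longrightarrow> degree G v = 1 \<Longrightarrow> v = p"
    and q2: "\<And>q. q \<in> neighbours G p \<Longrightarrow> degree G q = 2"
    unfolding tailed_def by blast
  obtain C u ws where C: "is_cycle_graph C" "u \<in> pverts C" "distinct ws" "set ws \<inter> pverts C = {}"
    and G: "G = attach_path C u ws"
  proof -
    have "\<exists>r. cycle_with_path r G"
      using only by (intro unique_pendant_imp_cycle_with_path[OF assms]) blast
    then show thesis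
      using that unfolding cycle_with_path_def by blast
  qed
  have "ws \<noteq> []" "p = last ws"
    using pendant_attach_path_iff[OF C, of p] p G by auto
  then obtain vs where vs: "ws = vs @ [p]"
    by (metis append_butlast_last_id)
  have "vs \<noteq> []"
  proof
    assume [simp]: "vs = []"
    have "degree G u = 3"
      using degree_attach_path_snoc[of C u "[]" p u] C degree_cycle[OF C(1)] by (auto simp: G vs)
    moreover have "u \<in> neighbours G p"
      using neighbours_last_attach_path[of C u "[]" p] C by (simp add: G vs)
    ultimately show False
      using q2 by force
  qed
  then have "length ws \<ge> 2"
    using vs by (cases vs) auto
  then show "\<exists>r\<ge>2. cycle_with_path r G"
    using C G unfolding cycle_with_path_def by blast
next
  assume "\<exists>r\<ge>2. cycle_with_path r G"
  then obtain C u ws where C: "is_cycle_graph C" "u \<in> pverts C" "distinct ws" "set ws \<inter> pverts C = {}"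
    and len: "length ws \<ge> 2" and G: "G = attach_path C u ws"
    unfolding cycle_with_path_def by blast
  obtain us p where us: "ws = us @ [p]"
    using len by (cases ws rule: rev_cases) auto
  moreover obtain vs q where "us = vs @ [q]"
    using len us by (cases us rule: rev_cases) auto
  ultimately have ws: "ws = (vs @ [q]) @ [p]"
    by simp
  note C' = C[unfolded ws]
  have p: "p \<in> pverts G" "degree G p = 1" "\<forall>v\<in>pverts G. degree G v = 1 \<longrightarrow> v = p"
    using pendant_attach_path_iff[OF C] by (auto simp: G ws)
  have "neighbours G p = {q}"
    using neighbours_last_attach_path[OF C'] by (simp add: G ws)
  \<comment> \<open>\<open>q\<close> was the pendant end of the shorter path; appending
    \<open>p\<close> raises its degree from 1 to 2.\<close>
  moreover have "degree G q = 2"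
    using degree_attach_path_snoc[OF C', of q] pendant_attach_path_iff[of C u "vs @ [q]" q] C'
    by (auto simp: G ws)
  ultimately have "\<forall>v\<in>neighbours G p. degree G v = 2"
    by simp
  with p show "tailed G"
    unfolding tailed_def by blast
qed

lemma maximizersI:
  assumes "A \<subseteq> S" "A \<noteq> {}" "\<And>x. x \<in> A \<Longrightarrow> f x = c" "\<And>x. x \<in> S \<Longrightarrow> x \<notin> A \<Longrightarrow> f x < c"
  shows "maximizers f S = A \<and> f ` maximizers f S = {c}"
proof -
  have le: "f x \<le> c" if "x \<in> S" for x
    using assms(3,4) that by (metis order.order_iff_strict)
  obtain a where "a \<in> A"
    using assms(2) by blast
  have "maximizers f S = A"
  proof (intro set_eqI iffI)
    fix x assume "x \<in> maximizers f S"
    then have "x \<in> S" "\<not> f x < f a"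
      using \<open>a \<in> A\<close> assms(1) by (auto simp: maximizers_def is_arg_max_def)
    then show "x \<in> A"
      using assms(3)[OF \<open>a \<in> A\<close>] assms(4) by auto
  next
    fix x assume "x \<in> A"
    then show "x \<in> maximizers f S"
      using assms(1,3) le by (force simp: maximizers_def is_arg_max_def)
  qed
  then show ?thesis
    using assms(2,3) by force
qed

text \<open>Degree 2 among three vertices means adjacency to both others. A triangle is thus
  determined by its vertex set, and any labelling of it is an isomorphism.\<close>

lemma triangle_parcs:
  assumes "is_cycle_graph C" "card (pverts C) = 3"
  shows "parcs C = {(x, y). x \<in> pverts C \<and> y \<in> pverts C \<and> x \<noteq> y}"
proof -
  note C = pair_graph_cycle[OF assms(1)]
  have "neighbours C v = pverts C - {v}" if "v \<in> pverts C" for v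
  proof (rule card_subset_eq)
    show "finite (pverts C - {v})" "neighbours C v \<subseteq> pverts C - {v}"
      using C by (auto simp: neighbours_def pair_graph_iff)
    show "card (neighbours C v) = card (pverts C - {v})"
      using degree_cycle[OF assms(1) that] assms(2) that by (simp add: degree_def)
  qed
  then show ?thesis
    by (auto simp: parcs_eq_Sigma[OF C])
qed

lemma cycle_with_path_4_1E:
  assumes "card (pverts G) = 4" "cycle_with_path 1 G"
  obtains C u a b w where "is_cycle_graph C" "card (pverts C) = 3" "pverts C = {u, a, b}"
    "distinct [u, a, b, w]" "G = attach_path C u [w]"
proof -
  obtain C u ws where C: "is_cycle_graph C" "u \<in> pverts C" "distinct ws"
    "set ws \<inter> pverts C = {}" "length ws = 1" and G: "G = attach_path C u ws"
    using assms(2) unfolding cycle_with_path_def by blast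
  then obtain w where w: "ws = [w]"
    by (auto simp: length_Suc_conv)
  have fin: "finite (pverts C)"
    using pair_graph_cycle[OF C(1)] by (simp add: pair_graph_iff)
  have card3: "card (pverts C) = 3"
    using assms(1) C(4) fin by (simp add: G w)
  then have "card (pverts C - {u}) = 2"
    using C(2) by simp
  then obtain a b where ab: "pverts C - {u} = {a, b}" "a \<noteq> b"
    by (meson card_2_iff)
  then have "pverts C = {u, a, b}" "distinct [u, a, b, w]"
    using C(2,4) w by auto
  with that C(1) card3 G w show thesis
    by blast
qed

lemma graph_iso_U_graph_4_3_iff:
  "graph_iso G (U_graph 4 3) \<longleftrightarrow> card (pverts G) = 4 \<and> cycle_with_path 1 G" (is "?L \<longleftrightarrow> ?R")
proof -
  have U: "U_graph 4 3 = attach_path (cycle_graph 3) 0 [3]"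
    by (simp add: U_graph_def upt_rec)
  have verts: "pverts (U_graph 4 3) = {0..<4}"
    by (auto simp: U)
  have "parcs (U_graph 4 3) \<subseteq> pverts (U_graph 4 3) \<times> pverts (U_graph 4 3)"
    by (auto simp: U attach_path_def cycle_graph_arc_iff)
  then have iso: "?L \<longleftrightarrow> (\<exists>f. inj_on f {0..<4} \<and> G = map_graph f (U_graph 4 3))"
    by (simp add: graph_iso_iff' verts)
  have map_U: "map_graph f (U_graph 4 3) = attach_path (map_graph f (cycle_graph 3)) (f 0) [f 3]"
    for f :: "nat \<Rightarrow> 'a"
    by (simp add: U map_graph_attach_path)
  have cyc: "is_cycle_graph (map_graph f (cycle_graph 3))" if "inj_on f {0..<4}"
    for f :: "nat \<Rightarrow> 'a"
    unfolding is_cycle_graph_iff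
    using inj_on_subset[OF that, of "{0..<3}"] by (intro exI[of _ 3] exI[of _ f]) auto
  show ?thesis
  proof
    assume ?L
    then obtain f where f: "inj_on f {0..<4}" and G: "G = map_graph f (U_graph 4 3)"
      unfolding iso by blast
    have "card (pverts G) = 4"
      by (simp add: G verts card_image[OF f])
    moreover have "f 3 \<notin> f ` {0..<3}"
      using inj_on_image_mem_iff[OF f, of 3 "{0..<3}"] by simp
    then have "cycle_with_path 1 G"
      unfolding cycle_with_path_def G map_U using cyc[OF f]
      by (intro exI[of _ "map_graph f (cycle_graph 3)"] exI[of _ "f 0"] exI[of _ "[f 3]"]) simp
    ultimately show ?R
      by simp
  next
    assume R: ?R
    then obtain C u a b w where C: "is_cycle_graph C" and card3: "card (pverts C) = 3"
      and V: "pverts C = {u, a, b}" and dist: "distinct [u, a, b, w]"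
      and G: "G = attach_path C u [w]"
      using cycle_with_path_4_1E by metis
    \<comment> \<open>In \<open>U_graph 4 3\<close> the path is attached at \<open>0\<close> and its
      vertex is \<open>3\<close>, so \<open>u\<close> comes first and \<open>w\<close> last; the
      order of \<open>a\<close> and \<open>b\<close> does not matter.\<close>
    let ?f = "(!) [u, a, b, w]"
    have inj: "inj_on ?f {0..<4}"
      using dist by (intro inj_on_nth) auto
    have img: "?f ` {0..<3} = {u, a, b}"
      by (simp add: numeral_3_eq_3 atLeast0_lessThan_Suc insert_commute)
    have "map_graph ?f (cycle_graph 3) = C"
      using triangle_parcs[OF C card3] triangle_parcs[OF cyc[OF inj]] card3
      by (intro pair_graph_eqI) (simp_all add: img V)
    then have "G = map_graph ?f (U_graph 4 3)"
      unfolding map_U G by simp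
    with inj show ?L
      unfolding iso by blast
  qed
qed

lemma sum_connectivity_index_paw:
  assumes "card (pverts G) = 4" "cycle_with_path 1 G"
  shows "sum_connectivity_index G = 1 + 2 / sqrt 5"
proof -
  obtain C u a b w where C: "is_cycle_graph C" and card3: "card (pverts C) = 3"
    and V: "pverts C = {u, a, b}" and dist: "distinct [u, a, b, w]"
    and G: "G = attach_path C u [w]"
    using assms cycle_with_path_4_1E by metis
  have ne: "u \<noteq> a" "u \<noteq> b" "a \<noteq> b" "w \<noteq> u" "w \<noteq> a" "w \<noteq> b"
    using dist by auto
  have arcs: "parcs G = {(u, a), (a, u), (u, b), (b, u), (a, b), (b, a), (u, w), (w, u)}"
    using dist by (auto simp: G attach_path_def triangle_parcs[OF C card3] V)
  have deg: "degree G v = (if v = w then 1 else if v = u then 3 else 2)" if "v \<in> {u, a, b, w}" for v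
    using degree_attach_path_snoc[of C u "[]" w v] C degree_cycle[OF C] that V dist
    by (auto simp: G)
  have "pair_graph G"
    using unicyclic_cycle_with_path[OF assms(2)] by (simp add: unicyclic_iff)
  \<comment> \<open>The edges \<open>ua\<close> and \<open>ub\<close> have degree sum 5. The edges
    \<open>ab\<close> (2 + 2) and \<open>uw\<close> (3 + 1) both have degree sum 4.\<close>
  then have "2 * sum_connectivity_index G = 4 * (1 / sqrt 5) + 4 * (1 / sqrt 4)"
    using ne by (simp add: sum_connectivity_index_arcs arcs deg)
  then show ?thesis
    by simp
qed

text \<open>A cycle takes at least three of the four vertices and pendant vertices lie off it, so at
  most one vertex is pendant. Counting vertices then fixes the path length at 1.\<close>

lemma unicyclic_4_cases:
  assumes "unicyclic G" "card (pverts G) = 4" "\<not> is_cycle_graph G"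
  shows "cycle_with_path 1 G"
proof -
  have G: "pair_graph G" and fin: "finite (pverts G)"
    using assms(1) by (auto simp: unicyclic_iff pair_graph_iff)
  obtain C where C: "is_cycle_graph C" "pverts C \<subseteq> pverts G" "parcs C \<subseteq> parcs G"
    using assms(1) unfolding unicyclic_iff by blast
  have notin: "v \<notin> pverts C" if "degree G v = 1" for v
  proof
    assume "v \<in> pverts C"
    moreover have "card (neighbours C v) \<le> card (neighbours G v)"
      using finite_neighbours[OF G] C(3) by (intro card_mono) (auto simp: neighbours_def)
    ultimately show False
      using degree_cycle[OF C(1)] that by (simp add: degree_def)
  qed
  have "card (pverts G - pverts C) \<le> 1"
    using card_cycle[OF C(1)] assms(2) C(2) fin by (simp add: card_Diff_subset finite_subset)
  then have "v = w" if "v \<in> pverts G - pverts C" "w \<in> pverts G - pverts C" for v w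
    using that fin by (metis card_le_Suc0_iff_eq finite_Diff One_nat_def)
  then have "\<exists>r. cycle_with_path r G"
    using notin by (intro unique_pendant_imp_cycle_with_path[OF assms(1)]) blast
  then obtain D u ws where D: "is_cycle_graph D" "u \<in> pverts D" "distinct ws"
    "set ws \<inter> pverts D = {}" and GD: "G = attach_path D u ws"
    unfolding cycle_with_path_def by blast
  have "finite (pverts D)"
    using pair_graph_cycle[OF D(1)] by (simp add: pair_graph_iff)
  then have "card (pverts G) = card (pverts D) + length ws"
    using D(3,4) by (simp add: GD card_Un_disjoint Int_commute distinct_card)
  moreover have "ws \<noteq> []"
    using assms(3) D(1) GD by auto
  ultimately have "length ws = 1"
    using card_cycle[OF D(1)] assms(2) length_greater_0_conv[of ws] by linarith
  then show ?thesis
    using D GD unfolding cycle_with_path_def by blast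
qed

text \<open>The vertex type may be finite. The assumption on \<open>V\<close> provides
  \<open>n\<close> distinct vertices; on a smaller type the family would be empty and no maximum
  would exist.\<close>

theorem theorem3:
  fixes n :: nat
  assumes "n \<ge> 4"
    and "\<exists>V :: 'a set. finite V \<and> card V = n"
  shows
    "maximizers sum_connectivity_index (unicyclic_graphs n :: 'a pair_pre_digraph set)
        = {G. graph_iso G (cycle_graph n)} \<and>
     sum_connectivity_index `
        maximizers sum_connectivity_index (unicyclic_graphs n :: 'a pair_pre_digraph set)
        = {real n / 2} \<and>
     (n = 4 \<longrightarrow>
        second_maximizers sum_connectivity_index (unicyclic_graphs n :: 'a pair_pre_digraph set)
          = {G. graph_iso G (U_graph 4 3)} \<and>
        sum_connectivity_index `
          second_maximizers sum_connectivity_index (unicyclic_graphs n :: 'a pair_pre_digraph set)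
          = {1 + 2 / sqrt 5}) \<and>
     (n \<ge> 5 \<longrightarrow>
        second_maximizers sum_connectivity_index (unicyclic_graphs n :: 'a pair_pre_digraph set)
          = {G. card (pverts G) = n \<and> (\<exists>r\<ge>2. cycle_with_path r G)} \<and>
        sum_connectivity_index `
          second_maximizers sum_connectivity_index (unicyclic_graphs n :: 'a pair_pre_digraph set)
          = {(real n - 4) / 2 + 1 / sqrt 3 + 3 / sqrt 5})"
proof -
  let ?S = "unicyclic_graphs n :: 'a pair_pre_digraph set"
  let ?c = "(real n - 4) / 2 + 1 / sqrt 3 + 3 / sqrt 5"
  define A where "A = {G :: 'a pair_pre_digraph. graph_iso G (cycle_graph n)}"
  obtain V :: "'a set" where V: "finite V" "card V = n"
    using assms(2) by blast
  have A_iff: "G \<in> A \<longleftrightarrow> is_cycle_graph G \<and> card (pverts G) = n" for G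
    using assms(1) by (simp add: A_def graph_iso_cycle_graph_iff)
  have S_iff: "G \<in> ?S \<longleftrightarrow> unicyclic G \<and> card (pverts G) = n" for G
    by (simp add: unicyclic_graphs_def)
  have facts: "pair_graph G" "linked G" "card (parcs G) \<le> 2 * card (pverts G)" if "G \<in> ?S" for G
    using that card_parcs_unicyclic_le[of G] by (simp_all add: S_iff unicyclic_iff)
  have pendant: "\<exists>p\<in>pverts G. degree G p = 1" if "G \<in> ?S - A" for G
    using that unicyclic_cases[of G] by (auto simp: S_iff A_iff)
  have tailed_value: "sum_connectivity_index G = ?c" if "G \<in> ?S" "tailed G" for G
    using sum_connectivity_index_tailed[OF facts(1,3)[OF that(1)] _ that(2)]
      degree_pos[OF facts(1,2)[OF that(1)]] assms(1) that(1) by (simp add: S_iff)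
  have less: "sum_connectivity_index G < ?c" if "G \<in> ?S - A" "\<not> tailed G" for G
    using sum_connectivity_index_less[of G] facts[of G] pendant[OF that(1)] assms(1) that
    by (simp add: S_iff)
  have c_less: "?c < real n / 2"
  proof -
    have "3 / sqrt 5 = 3 * (1 / sqrt 5)"
      by simp
    then show ?thesis
      using inverse_sqrt_bounds by argo
  qed
  have A_sub: "A \<subseteq> ?S"
    using unicyclic_cycle by (auto simp: A_iff S_iff)
  obtain f where "bij_betw f {0..<n} V"
    using V ex_bij_betw_nat_finite by metis
  then have inj: "inj_on f {0..<n}"
    by (simp add: bij_betw_def)
  moreover have "is_cycle_graph (map_graph f (cycle_graph n))"
    unfolding is_cycle_graph_iff using assms(1) inj by (intro exI[of _ n] exI[of _ f]) simp
  ultimately have "map_graph f (cycle_graph n) \<in> A"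
    by (simp add: A_iff card_image)
  then have A_ne: "A \<noteq> {}"
    by blast
  have first: "maximizers sum_connectivity_index ?S = A \<and>
    sum_connectivity_index ` maximizers sum_connectivity_index ?S = {real n / 2}"
  proof (rule maximizersI[OF A_sub A_ne])
    show "sum_connectivity_index G = real n / 2" if "G \<in> A" for G
      using that sum_connectivity_index_cycle[of G] by (simp add: A_iff)
    \<comment> \<open>Every graph other than the cycle has index at most \<open>?c\<close>. This
      also covers \<open>n = 4\<close>, where \<open>?c\<close> is only an upper bound.\<close>
    show "sum_connectivity_index G < real n / 2" if "G \<in> ?S" "G \<notin> A" for G
      using that less[of G] tailed_value[of G] c_less
      by (cases "tailed G") (simp, blast intro: order.strict_trans)
  qed
  have not_A: "G \<notin> A" if "cycle_with_path r G" "r \<ge> 1" for G r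
    using cycle_with_path_pendant[OF that] cycle_no_pendant[of G] by (auto simp: A_iff)
  have four: "second_maximizers sum_connectivity_index ?S = {G. graph_iso G (U_graph 4 3)} \<and>
      sum_connectivity_index ` second_maximizers sum_connectivity_index ?S = {1 + 2 / sqrt 5}"
    if n4: "n = 4"
  proof -
    let ?B = "{G :: 'a pair_pre_digraph. graph_iso G (U_graph 4 3)}"
    have B: "G \<in> ?B \<longleftrightarrow> card (pverts G) = 4 \<and> cycle_with_path 1 G" for G
      by (simp add: graph_iso_U_graph_4_3_iff)
    have sub: "?B \<subseteq> ?S - A"
    proof
      fix G assume "G \<in> ?B"
      then have G: "card (pverts G) = n" "cycle_with_path 1 G"
        unfolding B n4 by blast+
      then show "G \<in> ?S - A"
        using not_A[OF G(2)] unicyclic_cycle_with_path[OF G(2)] by (simp add: S_iff)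
    qed
    have ne: "?B \<noteq> {}"
      using ex_cycle_with_path[of V 3 1] V n4 B by fastforce
    have val: "sum_connectivity_index G = 1 + 2 / sqrt 5" if "G \<in> ?B" for G
      using that sum_connectivity_index_paw unfolding B by blast
    \<comment> \<open>For \<open>n = 4\<close> nothing is left below second place, so the strict
      inequality required by \<open>maximizersI\<close> holds vacuously.\<close>
    have all: "G \<in> ?B" if "G \<in> ?S - A" for G
    proof -
      have "unicyclic G \<and> card (pverts G) = 4 \<and> \<not> is_cycle_graph G"
        using that n4 unfolding Diff_iff S_iff A_iff by blast
      then show ?thesis
        unfolding B using unicyclic_4_cases by blast
    qed
    show ?thesis
      unfolding second_maximizers_def first[THEN conjunct1]
      by (rule maximizersI[OF sub ne val]) (use all in blast)+
  qed
  have five: "second_maximizers sum_connectivity_index ?S =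
        {G. card (pverts G) = n \<and> (\<exists>r\<ge>2. cycle_with_path r G)} \<and>
      sum_connectivity_index ` second_maximizers sum_connectivity_index ?S = {?c}"
    if "n \<ge> 5"
  proof -
    let ?B = "{G :: 'a pair_pre_digraph. card (pverts G) = n \<and> (\<exists>r\<ge>2. cycle_with_path r G)}"
    have tail: "G \<in> ?B \<longleftrightarrow> tailed G" if "G \<in> ?S" for G
      using that tailed_iff_cycle_with_path by (auto simp: S_iff)
    have sub: "?B \<subseteq> ?S - A"
    proof
      fix G assume "G \<in> ?B"
      then obtain r where r: "card (pverts G) = n" "r \<ge> 2" "cycle_with_path r G"
        by blast
      then show "G \<in> ?S - A"
        using not_A[of r G] unicyclic_cycle_with_path by (simp add: S_iff)
    qed
    \<comment> \<open>A cycle on \<open>n - 2\<close> vertices needs \<open>n \<ge> 5\<close>; here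
      the case \<open>n = 4\<close> parts company.\<close>
    have "\<exists>G :: 'a pair_pre_digraph. card (pverts G) = (n - 2) + 2 \<and> cycle_with_path 2 G"
      using V that by (intro ex_cycle_with_path[of V]) auto
    moreover have "n - 2 + 2 = n"
      using that by simp
    ultimately have ne: "?B \<noteq> {}"
      by auto
    have val: "sum_connectivity_index G = ?c" if "G \<in> ?B" for G
      using that sub tail tailed_value by blast
    have lt: "sum_connectivity_index G < ?c" if "G \<in> ?S - A" "G \<notin> ?B" for G
      using that tail less by blast
    show ?thesis
      unfolding second_maximizers_def first[THEN conjunct1]
      by (rule maximizersI[OF sub ne val lt])
  qed
  show ?thesis
    using first four five unfolding A_def by blast
qed

end
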